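(* Let $N\ge 2$, let $(\Omega,\mathcal F,\mathbb P)$ be a probability space, and let $\theta=\{\theta_t\}_{t\in\mathbb R}$ be a metric dynamical system on it. Let $q_1,\dots,q_{2N-2}:\Omega\to\mathbb R$ be $\mathcal F$-measurable functions for which there are constants $c_*,C_*$ with $$0<c_*\le q_i(\omega)\le C_*<\infty\qquad\text{for all } i=1,\dots,2N-2,\ \omega\in\Omega.$$ For $\omega\in\Omega$ let $Q(\omega)$ be the $N\times N$ tridiagonal matrix with off-diagonal entries $Q_{i+1,i}(\omega)=q_{2i-1}(\omega)$ and $Q_{i,i+1}(\omega)=q_{2i}(\omega)$ for $1\le i\le N-1$, with diagonal entries $Q_{1,1}=-q_1$, $Q_{i,i}=-(q_{2i-2}+q_{2i-1})$ for $2\le i\le N-1$, $Q_{N,N}=-q_{2N-2}$, and with all other entries zero (so every column of $Q(\omega)$ sums to $0$). Let $p(t;\omega,p_0)$, $t\ge 0$, denote the solution of $$\frac{dp}{dt}=Q(\theta_t\omega)\,p,\qquad p(0)=p_0\in\mathbb R^N .$$ Let $\Sigma_N=\{p\in\mathbb R^N: p_j\in[0,1],\ \sum_{j=1}^N p_j=1\}$ and $\overset{\circ}{\Sigma}_N=\{p\in\Sigma_N: p_j>0\ \forall j\}$. Then the restriction of $\varphi(t,\omega,\cdot):=p(t;\omega,\cdot)$ to $\Sigma_N$ is a cocycle on $\Sigma_N$ with respect to $\theta$ which is uniformly dissipative and uniformly contractive with respect to the Hilbert projective metric $\rho_H$. It has a random attractor $\mathscr A=\{A(\omega):\omega\in\Omega\}$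 such that for each $\omega\in\Omega$ the set $A(\omega)=\{a(\omega)\}$ consists of a single point. Moreover, the random attractor is asymptotically stable, i.e. $$\|p(t;\omega,p_0)-a(\theta_t\omega)\|\to 0\quad\text{as } t\to\infty$$ for all $p_0\in\overset{\circ}{\Sigma}_N$ and all $\omega\in\Omega$.
   Context: Metric dynamical system: a family of maps $\theta_t:\Omega\to\Omega$, $t\in\mathbb R$, with $\theta_0=\mathrm{id}_\Omega$ and $\theta_t\circ\theta_s=\theta_{t+s}$ for all $t,s\in\mathbb R$, with $(t,\omega)\mapsto\theta_t\omega$ jointly measurable, and with $\mathbb P(\theta_tB)=\mathbb P(B)$ for all $B\in\mathcal F$, $t\in\mathbb R$. Solution: for fixed $\omega$, the differential equation is understood in the Carathéodory sense: a solution is a locally absolutely continuous function satisfying the equation for almost every $t$. Under the stated bounds the solution with given initial value exists and is unique on $[0,\infty)$. $\|\cdot\|$ is a fixed norm on $\mathbb R^N$. Cocycle: a map $\varphi:\mathbb R^+\times\Omega\times M\to M$ (with $\mathbb R^+=[0,\infty)$) is a cocycle on $M$ with respect to $\theta$ if $\varphi(0,\omega,\cdot)=\mathrm{id}_M$ and $\varphi(t+s,\omega,x)=\varphi(s,\theta_t\omega,\varphi(t,\omega,x))$ for all $x\in M$, $\omega\in\Omega$, $t,s\in\mathbb R^+$. Hilbert projective metric: for $x,y\in\overset{\circ}{\Sigma}_N$, $$\rho_H(x,y)=\ln\Big(\max_i\frac{y_i}{x_i}\cdot\max_i\frac{x_i}{y_i}\Big).$$ With this metric $\overset{\circ}{\Sigma}_N$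 is a complete metric space. For general $x,y\in\Sigma_N$, $\rho_H$ takes values in $[0,\infty]$: $\rho_H(x,y)=\ln\big(m(y/x)\,m(x/y)\big)$ with $m(y/x)=\inf\{c\ge 0: y_i\le c\,x_i\ \forall i\}$ and $\inf\emptyset=+\infty$. Uniformly dissipative (on $M$ with metric $\rho$): there exist $T_d\in\mathbb R^+$ and a closed bounded (finite $\rho$-diameter) set $M_0\subset M$ such that $\varphi(T_d,\omega,M)\subseteq M_0$ for all $\omega\in\Omega$. Uniformly contractive: there exist $T_c\in\mathbb R^+$ and $\lambda\in[0,1)$ such that $\rho(\varphi(T_c,\omega,x),\varphi(T_c,\omega,y))\le\lambda\,\rho(x,y)$ for all $\omega\in\Omega$, $x,y\in M$ (no condition is imposed when $\rho(x,y)=\infty$). In the theorem these are applied with $M=\Sigma_N$, $\rho=\rho_H$. Random attractor: a family $\mathscr A=\{A(\omega):\omega\in\Omega\}$ of nonempty compact subsets of $M$ such that (1) $\omega\mapsto A(\omega)$ is $\mathcal F$-measurable, meaning $\omega\mapsto\inf_{y\in A(\omega)}\|x-y\|$ is $\mathcal F$-measurable for each $x$ (for singletons $A(\omega)=\{a(\omega)\}$: $a$ is $\mathcal F$-measurable); (2) $\varphi(t,\omega,A(\omega))=A(\theta_t\omega)$ for all $\omega\in\Omega$, $t\in\mathbb R^+$; (3) for every $\mathcal F$-measurable family $\{D(\omega):\omega\in\Omega\}$ of nonempty compact subsets of $M$ and every $\omega\in\Omega$, $\mathrm{dist}\big(\varphi(t,\theta_{-t}\omega,D(\theta_{-t}\omega)),A(\omega)\big)\to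 0$ as $t\to\infty$, where $\mathrm{dist}(B,A)=\sup_{b\in B}\inf_{a\in A}\rho(b,a)$. Here compactness of subsets of $\Sigma_N$ refers to the Euclidean topology and $\rho=\rho_H$. *)

theory Defs
  imports "HOL-Probability.Probability"
begin

section \<open>Random dynamical systems\<close>

locale metric_dynamical_system = prob_space M
  for M :: "'w measure" and \<theta> :: "real \<Rightarrow> 'w \<Rightarrow> 'w" +
  assumes joint_measurable: "(\<lambda>(t, \<omega>). \<theta> t \<omega>) \<in> borel \<Otimes>\<^sub>M M \<rightarrow>\<^sub>M M"
    and shift_zero: "\<omega> \<in> space M \<Longrightarrow> \<theta> 0 \<omega> = \<omega>"
    and shift_add: "\<omega> \<in> space M \<Longrightarrow> \<theta> t (\<theta> s \<omega>) = \<theta> (t + s) \<omega>"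
    and measure_preserving: "B \<in> sets M \<Longrightarrow> emeasure M (\<theta> t ` B) = emeasure M B"

text \<open>
  In what follows \<open>W\<close> is the sample space, \<open>S\<close> the state space, and \<open>\<rho>\<close> an extended-valued
  metric on \<open>S\<close>.
\<close>

definition is_cocycle ::
  "'w set \<Rightarrow> (real \<Rightarrow> 'w \<Rightarrow> 'w) \<Rightarrow> 'a set \<Rightarrow> (real \<Rightarrow> 'w \<Rightarrow> 'a \<Rightarrow> 'a) \<Rightarrow> bool" where
  "is_cocycle W \<theta> S \<phi> \<longleftrightarrow>
     (\<forall>t\<ge>0. \<forall>\<omega>\<in>W. \<forall>x\<in>S. \<phi> t \<omega> x \<in> S) \<and>
     (\<forall>\<omega>\<in>W. \<forall>x\<in>S. \<phi> 0 \<omega> x = x) \<and>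
     (\<forall>t\<ge>0. \<forall>s\<ge>0. \<forall>\<omega>\<in>W. \<forall>x\<in>S. \<phi> (t + s) \<omega> x = \<phi> s (\<theta> t \<omega>) (\<phi> t \<omega> x))"

definition metric_closed_in :: "'a set \<Rightarrow> ('a \<Rightarrow> 'a \<Rightarrow> ereal) \<Rightarrow> 'a set \<Rightarrow> bool" where
  "metric_closed_in S \<rho> C \<longleftrightarrow>
     C \<subseteq> S \<and> (\<forall>x\<in>S. (\<forall>e>0. \<exists>y\<in>C. \<rho> x y < e) \<longrightarrow> x \<in> C)"

definition metric_bounded :: "('a \<Rightarrow> 'a \<Rightarrow> ereal) \<Rightarrow> 'a set \<Rightarrow> bool" where
  "metric_bounded \<rho> C \<longleftrightarrow> (\<exists>R::real. \<forall>x\<in>C. \<forall>y\<in>C. \<rho> x y \<le> ereal R)"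

definition uniformly_dissipative ::
  "'w set \<Rightarrow> 'a set \<Rightarrow> ('a \<Rightarrow> 'a \<Rightarrow> ereal) \<Rightarrow> (real \<Rightarrow> 'w \<Rightarrow> 'a \<Rightarrow> 'a) \<Rightarrow> bool" where
  "uniformly_dissipative W S \<rho> \<phi> \<longleftrightarrow>
     (\<exists>T\<ge>0. \<exists>S0. metric_closed_in S \<rho> S0 \<and> metric_bounded \<rho> S0 \<and>
        (\<forall>\<omega>\<in>W. \<phi> T \<omega> ` S \<subseteq> S0))"

text \<open>
  Pairs at infinite distance are excluded explicitly because \<open>0 * \<infinity> = 0\<close> in \<^typ>\<open>ereal\<close>.
\<close>

definition uniformly_contractive ::
  "'w set \<Rightarrow> 'a set \<Rightarrow> ('a \<Rightarrow> 'a \<Rightarrow> ereal) \<Rightarrow> (real \<Rightarrow> 'w \<Rightarrow> 'a \<Rightarrow> 'a) \<Rightarrow> bool" where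
  "uniformly_contractive W S \<rho> \<phi> \<longleftrightarrow>
     (\<exists>T\<ge>0. \<exists>c::real. 0 \<le> c \<and> c < 1 \<and>
        (\<forall>\<omega>\<in>W. \<forall>x\<in>S. \<forall>y\<in>S. \<rho> x y < \<infinity> \<longrightarrow>
           \<rho> (\<phi> T \<omega> x) (\<phi> T \<omega> y) \<le> ereal c * \<rho> x y))"

definition is_norm :: "('a::real_vector \<Rightarrow> real) \<Rightarrow> bool" where
  "is_norm nrm \<longleftrightarrow>
     (\<forall>x. 0 \<le> nrm x) \<and> (\<forall>x. nrm x = 0 \<longleftrightarrow> x = 0) \<and>
     (\<forall>c x. nrm (c *\<^sub>R x) = \<bar>c\<bar> * nrm x) \<and> (\<forall>x y. nrm (x + y) \<le> nrm x + nrm y)"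

definition measurable_set_family ::
  "'w measure \<Rightarrow> ('a::real_vector \<Rightarrow> real) \<Rightarrow> ('w \<Rightarrow> 'a set) \<Rightarrow> bool" where
  "measurable_set_family M nrm D \<longleftrightarrow>
     (\<forall>x. (\<lambda>\<omega>. INF y\<in>D \<omega>. nrm (x - y)) \<in> borel_measurable M)"

definition compact_random_set ::
  "'w measure \<Rightarrow> 'a set \<Rightarrow> ('a::real_normed_vector \<Rightarrow> real) \<Rightarrow> ('w \<Rightarrow> 'a set) \<Rightarrow> bool" where
  "compact_random_set M S nrm D \<longleftrightarrow>
     (\<forall>\<omega>\<in>space M. D \<omega> \<noteq> {} \<and> compact (D \<omega>) \<and> D \<omega> \<subseteq> S) \<and> measurable_set_family M nrm D"

definition semi_dist :: "('a \<Rightarrow> 'a \<Rightarrow> ereal) \<Rightarrow> 'a set \<Rightarrow> 'a set \<Rightarrow> ereal" where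
  "semi_dist \<rho> B A = (SUP b\<in>B. INF a\<in>A. \<rho> b a)"

definition random_attractor ::
  "'w measure \<Rightarrow> (real \<Rightarrow> 'w \<Rightarrow> 'w) \<Rightarrow> 'a set \<Rightarrow> ('a \<Rightarrow> 'a \<Rightarrow> ereal) \<Rightarrow>
   ('a::real_normed_vector \<Rightarrow> real) \<Rightarrow> (real \<Rightarrow> 'w \<Rightarrow> 'a \<Rightarrow> 'a) \<Rightarrow> ('w \<Rightarrow> 'a set) \<Rightarrow> bool" where
  "random_attractor M \<theta> S \<rho> nrm \<phi> A \<longleftrightarrow>
     compact_random_set M S nrm A \<and>
     (\<forall>\<omega>\<in>space M. \<forall>t\<ge>0. \<phi> t \<omega> ` A \<omega> = A (\<theta> t \<omega>)) \<and>
     (\<forall>D. compact_random_set M S nrm D \<longrightarrow>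
        (\<forall>\<omega>\<in>space M.
           ((\<lambda>t. semi_dist \<rho> (\<phi> t (\<theta> (- t) \<omega>) ` D (\<theta> (- t) \<omega>)) (A \<omega>)) \<longlongrightarrow> 0) at_top))"

section \<open>The simplex and the Hilbert projective metric\<close>

definition prob_simplex :: "(real ^ 'n::finite) set" where
  "prob_simplex = {p. (\<forall>j. 0 \<le> p $ j \<and> p $ j \<le> 1) \<and> (\<Sum>j\<in>UNIV. p $ j) = 1}"

definition open_prob_simplex :: "(real ^ 'n::finite) set" where
  "open_prob_simplex = {p \<in> prob_simplex. \<forall>j. 0 < p $ j}"

text \<open>\<open>max_ratio y x\<close> is $m(y/x)$; the infimum of the empty set is \<open>\<infinity>\<close> in \<^typ>\<open>ereal\<close>.\<close>

definition max_ratio :: "real ^ 'n::finite \<Rightarrow> real ^ 'n \<Rightarrow> ereal" where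
  "max_ratio y x = Inf (ereal ` {c. 0 \<le> c \<and> (\<forall>i. y $ i \<le> c * x $ i)})"

definition hilbert_metric :: "real ^ 'n::finite \<Rightarrow> real ^ 'n \<Rightarrow> ereal" where
  "hilbert_metric x y =
     (let r = max_ratio y x * max_ratio x y
      in if r = \<infinity> then \<infinity> else ereal (ln (real_of_ereal r)))"

lemma max_ratio_pos:
  fixes x y :: "real ^ 'n::finite"
  assumes x: "\<And>i. 0 < x $ i" and y: "\<And>i. 0 < y $ i"
  shows "max_ratio y x = ereal (Max (range (\<lambda>i. y $ i / x $ i)))"
proof -
  let ?m = "Max (range (\<lambda>i. y $ i / x $ i))"
  have le: "y $ i / x $ i \<le> ?m" for i
    by (rule Max_ge) auto
  have nonneg: "0 \<le> ?m"
    using le[of undefined] x[of undefined] y[of undefined]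
    by (meson divide_nonneg_pos less_imp_le order_trans)
  have "max_ratio y x \<le> ereal ?m"
    unfolding max_ratio_def
    using nonneg iffD1[OF pos_divide_le_eq[OF x] le]
    by (intro Inf_lower imageI) blast
  moreover have "ereal ?m \<le> max_ratio y x"
    unfolding max_ratio_def
  proof (rule Inf_greatest)
    fix z assume "z \<in> ereal ` {c. 0 \<le> c \<and> (\<forall>i. y $ i \<le> c * x $ i)}"
    then obtain c where "z = ereal c" "\<And>i. y $ i \<le> c * x $ i" by auto
    then show "ereal ?m \<le> z"
      using x by (auto simp: pos_divide_le_eq)
  qed
  ultimately show ?thesis by (rule antisym)
qed

lemma hilbert_metric_open_simplex:
  fixes x y :: "real ^ 'n::finite"
  assumes "x \<in> open_prob_simplex" "y \<in> open_prob_simplex"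
  shows "hilbert_metric x y =
    ereal (ln (Max (range (\<lambda>i. y $ i / x $ i)) * Max (range (\<lambda>i. x $ i / y $ i))))"
  using assms max_ratio_pos[of x y] max_ratio_pos[of y x]
  by (simp add: hilbert_metric_def open_prob_simplex_def)

section \<open>Linear random differential equations\<close>

text \<open>Absolute continuity, with the finite families of nonoverlapping intervals as divisions.\<close>

definition absolutely_continuous_on :: "real set \<Rightarrow> (real \<Rightarrow> 'a::real_normed_vector) \<Rightarrow> bool" where
  "absolutely_continuous_on I f \<longleftrightarrow>
     (\<forall>e>0. \<exists>d>0. \<forall>D U. D division_of U \<and> U \<subseteq> I \<and> (\<Sum>K\<in>D. measure lborel K) < d \<longrightarrow>
        (\<Sum>K\<in>D. norm (f (Sup K) - f (Inf K))) < e)"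

definition caratheodory_solution ::
  "(real \<Rightarrow> real ^ 'n ^ 'n) \<Rightarrow> real ^ 'n \<Rightarrow> (real \<Rightarrow> real ^ 'n::finite) \<Rightarrow> bool" where
  "caratheodory_solution A p0 u \<longleftrightarrow>
     u 0 = p0 \<and>
     (\<forall>T\<ge>0. absolutely_continuous_on {0..T} u) \<and>
     (AE t in lborel. 0 \<le> t \<longrightarrow> (u has_vector_derivative A t *v u t) (at t within {0..}))"

text \<open>
  Solutions are only determined on \<open>[0,\<infinity>)\<close>, so the description is of the value at \<open>t \<ge> 0\<close>
  rather than of the function on \<^typ>\<open>real\<close>.
\<close>

definition solution_at :: "(real \<Rightarrow> real ^ 'n ^ 'n) \<Rightarrow> real ^ 'n \<Rightarrow> real \<Rightarrow> real ^ 'n::finite" where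
  "solution_at A p0 t = (THE x. \<exists>u. caratheodory_solution A p0 u \<and> u t = x)"

text \<open>
  The indices \<open>1, \<dots>, N\<close> are the elements of a finite linearly ordered type \<open>'n\<close> in increasing
  order; \<open>pos i\<close> is the number of \<open>i\<close>.
\<close>

definition pos :: "'n::{finite,linorder} \<Rightarrow> nat" where
  "pos i = card {..i}"

lemma strict_mono_pos: "strict_mono (pos :: 'n::{finite,linorder} \<Rightarrow> nat)"
  unfolding strict_mono_def pos_def by (auto intro!: psubset_card_mono)

lemma bij_betw_pos: "bij_betw pos (UNIV :: 'n::{finite,linorder} set) {1..CARD('n)}"
proof -
  have inj: "inj (pos :: 'n \<Rightarrow> nat)"
    using strict_mono_pos by (rule strict_mono_imp_inj_on)
  have "range (pos :: 'n \<Rightarrow> nat) \<subseteq> {1..CARD('n)}"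
    by (auto simp: pos_def card_gt_0_iff Suc_le_eq intro!: card_mono)
  then have "range (pos :: 'n \<Rightarrow> nat) = {1..CARD('n)}"
    using inj by (intro card_subset_eq) (auto simp: card_image)
  with inj show ?thesis by (simp add: bij_betw_def)
qed

definition rate_matrix :: "(nat \<Rightarrow> real) \<Rightarrow> real ^ ('n::{finite,linorder}) ^ ('n::{finite,linorder})" where
  "rate_matrix q = (\<chi> i j.
     if pos i = pos j + 1 then q (2 * pos j - 1)
     else if pos j = pos i + 1 then q (2 * pos i)
     else if i = j then
       (if pos i = 1 then - q 1
        else if pos i = CARD('n) then - q (2 * CARD('n) - 2)
        else - (q (2 * pos i - 2) + q (2 * pos i - 1)))
     else 0)"

definition rde_flow ::
  "(real \<Rightarrow> 'w \<Rightarrow> 'w) \<Rightarrow> (nat \<Rightarrow> 'w \<Rightarrow> real) \<Rightarrow>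
   real \<Rightarrow> 'w \<Rightarrow> real ^ 'n::{finite,linorder} \<Rightarrow> real ^ 'n::{finite,linorder}" where
  "rde_flow \<theta> q t \<omega> p0 = solution_at (\<lambda>s. rate_matrix (\<lambda>i. q i (\<theta> s \<omega>))) p0 t"

end

theory Submission
  imports Defs
begin

text \<open>
  Shifting the generator by a multiple of the identity makes it a nonnegative matrix, so the Picard
  series of the shifted equation is a sum of nonnegative terms; as \<open>Q\<close> is tridiagonal with
  off-diagonal entries at least \<open>c\<close>, after time \<open>1\<close> every probability vector has all entries above a
  constant \<open>\<epsilon>\<close> that does not depend on \<open>\<omega>\<close>. If \<open>y \<le> m x\<close> holds componentwise, then the flow \<open>P\<close> up to
  time \<open>1\<close> gives \<open>P y \<le> m powr (1 - \<epsilon>) * P x\<close>. Hence \<open>P\<close> contracts the Hilbert metric by the factor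
  \<open>1 - \<epsilon>\<close>, and all trajectories started at time \<open>-n\<close> come together at a geometric rate; the attractor
  point is their pullback limit.

  Caratheodory solutions are compared with solutions of the integral equation. One direction is the
  fundamental theorem of calculus for absolutely continuous functions, the other one is Lebesgue's
  differentiation theorem.
\<close>

section \<open>Lebesgue differentiation and absolute continuity\<close>

text \<open>The coefficients are merely bounded and measurable in time, so solutions are in general
  differentiable only almost everywhere; hence the detour through an integral equation. The flow is
  given by a definite description, whereas measurability of the attractor in \<open>\<omega>\<close>
  calls for a formula: the iterated integrals of the Picard series supply one. The Hilbert metric is
  infinite between points with different supports. The estimates are therefore carried by factors
  \<open>m\<close> with \<open>y \<le> m x\<close>, and logarithms are taken only at the end. After
  one unit of time all entries lie between \<epsilon> and 1, so 1 / \<epsilon> is a factor for any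
  two points, even for those at infinite distance; each further unit of time raises it to the power
  1 - \<epsilon>. The resulting factor depends neither on \<open>\<omega>\<close> nor on the
  starting points, so it serves pullback and forward convergence alike and bounds the supremum over
  any random set. As it tends to 1, it also controls the Euclidean distance, and the pullback limit
  is taken there.\<close>

text \<open>Disjoint Vitali intervals on which the difference quotient is off by \<open>\<eta>\<close> form a fine partial
  division, so Henstock's lemma bounds their total length.\<close>

lemma negligible_indefinite_integral_difference_quotient:
  fixes f :: "real \<Rightarrow> 'a::euclidean_space"
  assumes f: "f integrable_on {a..b}" and \<eta>: "0 < \<eta>"
  defines "F \<equiv> \<lambda>t. integral {a..t} f"
  shows "negligible {x \<in> {a..b}. \<forall>d>0. \<exists>y\<in>{a..b}. \<bar>y - x\<bar> < d \<and>
           \<eta> * \<bar>y - x\<bar> < norm (F y - F x - (y - x) *\<^sub>R f x)}" (is "negligible ?S")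
  unfolding negligible_outer_le
proof (intro allI impI)
  fix e :: real
  assume e: "0 < e"
  let ?J = "\<lambda>x y. {min x y..max x y}"
  \<comment> \<open>The tolerance is e * \<eta> because each bad interval contributes at least
    \<eta> times its length; the total length is then below e.\<close>
  obtain \<gamma> where \<gamma>: "gauge \<gamma>"
    and hen: "\<And>p. \<lbrakk>p tagged_partial_division_of (cbox a b); \<gamma> fine p\<rbrakk> \<Longrightarrow>
             sum (\<lambda>(x,k). norm (measure lborel k *\<^sub>R f x - integral k f)) p < e * \<eta>"
    by (rule Henstock_lemma[of f a b "e * \<eta>"]) (use f e \<eta> in auto)
  define K where "K = {(x,y). x \<in> {a..b} \<and> y \<in> {a..b} \<and> y \<noteq> x \<and> ?J x y \<subseteq> \<gamma> x \<and>
     \<eta> * \<bar>y - x\<bar> < norm (F y - F x - (y - x) *\<^sub>R f x)}"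
  \<comment> \<open>Midpoint and half length: they present the interval between the tag
    \<open>x\<close> and the second endpoint \<open>y\<close> as a ball, the form that Vitali's
    theorem expects.\<close>
  define A where "A = (\<lambda>(x::real,y). (x + y) / 2)"
  define R where "R = (\<lambda>(x::real,y). \<bar>y - x\<bar> / 2)"
  have J: "cball (A i) (R i) = ?J (fst i) (snd i)" for i
    unfolding A_def R_def cball_eq_atLeastAtMost
    by (auto simp: split_def abs_if min_def max_def field_simps)
  have Fdiff: "F y - F x = integral {x..y} f" if "a \<le> x" "x \<le> y" "y \<le> b" for x y
  proof -
    have "f integrable_on {a..y}"
      using f that by (auto intro: integrable_on_subinterval)
    then show ?thesis
      unfolding F_def using Henstock_Kurzweil_Integration.integral_combine[of a x y f] that
      by (simp add: algebra_simps)
  qed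
  have big: "\<eta> * measure lebesgue (?J x y) \<le> norm (measure lborel (?J x y) *\<^sub>R f x - integral (?J x y) f)"
    if "(x,y) \<in> K" for x y
  proof (cases "x \<le> y")
    case True
    with that Fdiff[of x y] show ?thesis
      by (auto simp: K_def norm_minus_commute)
  next
    case False
    then have "norm (F y - F x - (y - x) *\<^sub>R f x) = norm ((x - y) *\<^sub>R f x - (F x - F y))"
      by (simp add: algebra_simps)
    with False that Fdiff[of y x] show ?thesis
      by (auto simp: K_def)
  qed
  obtain C where C: "countable C" "C \<subseteq> K"
    and pw: "pairwise (\<lambda>i j. disjnt (cball (A i) (R i)) (cball (A j) (R j))) C"
    and neg: "negligible (?S - (\<Union>i\<in>C. cball (A i) (R i)))"
  proof (rule Vitali_covering_theorem_cballs[of K R ?S A])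
    fix i assume "i \<in> K" then show "0 < R i" by (auto simp: K_def R_def)
  next
    fix x d :: real assume x: "x \<in> ?S" and d: "0 < d"
    obtain \<delta> where \<delta>: "0 < \<delta>" "ball x \<delta> \<subseteq> \<gamma> x"
      using \<gamma> unfolding gauge_def open_contains_ball by blast
    obtain y where y: "y \<in> {a..b}" "\<bar>y - x\<bar> < min \<delta> d"
      "\<eta> * \<bar>y - x\<bar> < norm (F y - F x - (y - x) *\<^sub>R f x)"
    proof -
      have "0 < min \<delta> d" using \<delta>(1) d by simp
      with x that show ?thesis by blast
    qed
    have "?J x y \<subseteq> \<gamma> x"
      using y(2) by (intro order_trans[OF _ \<delta>(2)]) (auto simp: ball_def dist_real_def)
    then have "(x, y) \<in> K"
      using x y by (auto simp: K_def)
    moreover have "x \<in> cball (A (x,y)) (R (x,y))" by (simp add: J)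
    moreover have "R (x,y) < d" using y(2) d by (simp add: R_def)
    ultimately show "\<exists>i. i \<in> K \<and> x \<in> cball (A i) (R i) \<and> R i < d" by blast
  qed
  \<comment> \<open>Henstock's lemma speaks of finite partial divisions; a bound for all finite
    subfamilies passes to the countable Vitali family.\<close>
  have fin: "measure lebesgue (\<Union>i\<in>I. cball (A i) (R i)) \<le> e" if I: "I \<subseteq> C" "finite I" for I
  proof -
    define g where "g = (\<lambda>(x::real,y). (x, ?J x y))"
    have inj: "inj_on g I"
    proof (rule inj_onI, rule ccontr)
      fix i j assume ij: "i \<in> I" "j \<in> I" "g i = g j" "i \<noteq> j"
      then have "cball (A i) (R i) = cball (A j) (R j)" by (auto simp: g_def J split_def)
      moreover have "disjnt (cball (A i) (R i)) (cball (A j) (R j))"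
        using pw ij I by (auto simp: pairwise_def)
      ultimately show False by (auto simp: disjnt_def J split_def)
    qed
    have tag: "g ` I tagged_partial_division_of (cbox a b)"
      unfolding tagged_partial_division_of_def
    proof (intro conjI allI impI)
      show "finite (g ` I)" using I by simp
    next
      fix x k assume "(x, k) \<in> g ` I"
      then obtain y where "(x,y) \<in> K" "k = ?J x y" using I C by (auto simp: g_def)
      then show "x \<in> k" "k \<subseteq> cbox a b" "\<exists>a b. k = cbox a b" by (auto simp: K_def)
    next
      fix x1 k1 x2 k2 assume asm: "(x1, k1) \<in> g ` I \<and> (x2, k2) \<in> g ` I \<and> (x1, k1) \<noteq> (x2, k2)"
      then obtain i where i: "i \<in> I" "(x1, k1) = g i" by (auto simp del: split_paired_Ex)
      moreover from asm obtain j where "j \<in> I" "(x2, k2) = g j" by (auto simp del: split_paired_Ex)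
      moreover have "i \<noteq> j" using asm i \<open>(x2, k2) = g j\<close> by auto
      ultimately have ij: "i \<in> I" "j \<in> I" "(x1, k1) = g i" "(x2, k2) = g j" "i \<noteq> j"
        by simp_all
      have "disjnt (cball (A i) (R i)) (cball (A j) (R j))"
        using pw ij I by (auto simp: pairwise_def)
      moreover have "k1 = cball (A i) (R i)" "k2 = cball (A j) (R j)"
        using ij by (auto simp: g_def J split_def)
      ultimately show "interior k1 \<inter> interior k2 = {}"
        using interior_subset[of k1] interior_subset[of k2] unfolding disjnt_def by blast
    qed
    have "\<gamma> fine (g ` I)"
      using I C by (auto simp: fine_def g_def K_def)
    from hen[OF tag this]
    have *: "(\<Sum>i\<in>I. norm (measure lborel (?J (fst i) (snd i)) *\<^sub>R f (fst i) - integral (?J (fst i) (snd i)) f)) < e * \<eta>"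
      by (subst (asm) sum.reindex[OF inj]) (simp add: g_def split_def)
    have "\<eta> * measure lebesgue (\<Union>i\<in>I. cball (A i) (R i)) \<le> \<eta> * (\<Sum>i\<in>I. measure lebesgue (cball (A i) (R i)))"
      using \<eta> I by (intro mult_left_mono measure_UNION_le) auto
    also have "\<dots> = (\<Sum>i\<in>I. \<eta> * measure lebesgue (?J (fst i) (snd i)))"
      by (simp add: sum_distrib_left J)
    also have "\<dots> \<le> (\<Sum>i\<in>I. norm (measure lborel (?J (fst i) (snd i)) *\<^sub>R f (fst i) - integral (?J (fst i) (snd i)) f))"
      using I C by (intro sum_mono big) auto
    also note *
    finally have "\<eta> * measure lebesgue (\<Union>i\<in>I. cball (A i) (R i)) < \<eta> * e"
      by (simp only: mult.commute)
    then show ?thesis using \<eta> by (simp only: mult_less_cancel_left_pos less_imp_le)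
  qed
  have U: "(\<Union>i\<in>C. cball (A i) (R i)) \<in> lmeasurable" "measure lebesgue (\<Union>i\<in>C. cball (A i) (R i)) \<le> e"
    using fin by (auto intro!: fmeasurable_UN_bound[OF C(1)] measure_UN_bound[OF C(1)])
  let ?T = "(?S - (\<Union>i\<in>C. cball (A i) (R i))) \<union> (\<Union>i\<in>C. cball (A i) (R i))"
  have "measure lebesgue ?T = measure lebesgue (\<Union>i\<in>C. cball (A i) (R i))"
    by (rule measure_negligible_symdiff[OF U(1)]) (auto intro: negligible_subset[OF neg])
  moreover have "?T \<in> lmeasurable"
    by (rule fmeasurable.Un[OF negligible_imp_measurable[OF neg] U(1)])
  ultimately show "\<exists>T. ?S \<subseteq> T \<and> T \<in> lmeasurable \<and> measure lebesgue T \<le> e"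
    using U by (intro exI[of _ ?T]) auto
qed

text \<open>Where the derivative fails, the error quotient exceeds some inverse (Suc n) at
  arbitrarily near points, so the exceptional set is a countable union of the null sets just
  treated.\<close>

theorem indefinite_integral_has_vector_derivative_ae:
  fixes f :: "real \<Rightarrow> 'a::euclidean_space"
  assumes f: "f integrable_on {a..b}"
  shows "AE x in lborel. x \<in> {a..b} \<longrightarrow>
           ((\<lambda>t. integral {a..t} f) has_vector_derivative f x) (at x within {a..b})"
proof -
  let ?F = "\<lambda>t. integral {a..t} f"
  let ?S = "\<lambda>\<eta>. {x \<in> {a..b}. \<forall>d>0. \<exists>y\<in>{a..b}. \<bar>y - x\<bar> < d \<and>
           \<eta> * \<bar>y - x\<bar> < norm (?F y - ?F x - (y - x) *\<^sub>R f x)}"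
  have "negligible (\<Union>n. ?S (inverse (real (Suc n))))"
    by (intro negligible_Union_nat negligible_indefinite_integral_difference_quotient f) simp
  then have "AE x in lebesgue. x \<notin> (\<Union>n. ?S (inverse (real (Suc n))))"
    by (intro AE_not_in) (simp add: negligible_iff_null_sets)
  then have "AE x in lebesgue. x \<in> {a..b} \<longrightarrow>
           (?F has_vector_derivative f x) (at x within {a..b})"
  proof (rule AE_mp, intro AE_I2 impI)
    fix x assume nx: "x \<notin> (\<Union>n. ?S (inverse (real (Suc n))))" and x: "x \<in> {a..b}"
    show "(?F has_vector_derivative f x) (at x within {a..b})"
      unfolding has_vector_derivative_def has_derivative_within_alt
    proof (intro conjI allI impI)
      show "bounded_linear (\<lambda>h. h *\<^sub>R f x)" by (rule bounded_linear_scaleR_left)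
      fix e :: real assume "0 < e"
      then obtain n where n: "inverse (real (Suc n)) < e" using reals_Archimedean by blast
      have "x \<notin> ?S (inverse (real (Suc n)))" using nx by blast
      then have "\<exists>d>0. \<forall>y\<in>{a..b}. \<bar>y - x\<bar> < d \<longrightarrow>
          norm (?F y - ?F x - (y - x) *\<^sub>R f x) \<le> inverse (real (Suc n)) * \<bar>y - x\<bar>"
        using x unfolding mem_Collect_eq not_less[symmetric] by blast
      then obtain d where d: "d > 0" "\<And>y. y \<in> {a..b} \<Longrightarrow> \<bar>y - x\<bar> < d \<Longrightarrow>
          norm (?F y - ?F x - (y - x) *\<^sub>R f x) \<le> inverse (real (Suc n)) * \<bar>y - x\<bar>"
        by blast
      show "\<exists>d>0. \<forall>y\<in>{a..b}. norm (y - x) < d \<longrightarrow>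
               norm (?F y - ?F x - (y - x) *\<^sub>R f x) \<le> e * norm (y - x)"
      proof (intro exI conjI ballI impI)
        fix y assume "y \<in> {a..b}" "norm (y - x) < d"
        then have "norm (?F y - ?F x - (y - x) *\<^sub>R f x) \<le> inverse (real (Suc n)) * \<bar>y - x\<bar>"
          using d by auto
        also have "\<dots> \<le> e * norm (y - x)"
          using n by (auto intro!: mult_right_mono)
        finally show "norm (?F y - ?F x - (y - x) *\<^sub>R f x) \<le> e * norm (y - x)" .
      qed (use d in auto)
    qed
  qed
  then show ?thesis by (simp add: AE_completion_iff)
qed

text \<open>The solutions built from the Picard series are Lipschitz on bounded time intervals; this
  is their route to absolute continuity.\<close>

lemma lipschitz_imp_absolutely_continuous_on:
  fixes f :: "real \<Rightarrow> 'a::real_normed_vector"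
  assumes L: "\<And>x y. x \<in> I \<Longrightarrow> y \<in> I \<Longrightarrow> x \<le> y \<Longrightarrow> norm (f y - f x) \<le> L * (y - x)"
  shows "absolutely_continuous_on I f"
  unfolding absolutely_continuous_on_def
proof (intro allI impI)
  fix e :: real assume e: "0 < e"
  \<comment> \<open>The added 1 keeps the divisor in \<open>e / ?L\<close> positive.\<close>
  let ?L = "\<bar>L\<bar> + 1"
  show "\<exists>d>0. \<forall>D U. D division_of U \<and> U \<subseteq> I \<and> (\<Sum>K\<in>D. measure lborel K) < d \<longrightarrow>
        (\<Sum>K\<in>D. norm (f (Sup K) - f (Inf K))) < e"
  proof (intro exI[of _ "e / ?L"] conjI allI impI)
    fix D U assume *: "D division_of U \<and> U \<subseteq> I \<and> (\<Sum>K\<in>D. measure lborel K) < e / ?L"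
    have "(\<Sum>K\<in>D. norm (f (Sup K) - f (Inf K))) \<le> (\<Sum>K\<in>D. ?L * measure lborel K)"
    proof (rule sum_mono)
      fix K assume K: "K \<in> D"
      then obtain u v where uv: "K = cbox u v" "K \<noteq> {}" "K \<subseteq> U"
        using division_ofD(2,3,4)[of D U K] * by blast
      then have "u \<le> v" "u \<in> I" "v \<in> I" using * by auto
      then have "norm (f v - f u) \<le> L * (v - u)" by (intro L)
      also have "\<dots> \<le> ?L * (v - u)" using \<open>u \<le> v\<close> by (intro mult_right_mono) auto
      finally show "norm (f (Sup K) - f (Inf K)) \<le> ?L * measure lborel K"
        using uv \<open>u \<le> v\<close> by simp
    qed
    also have "\<dots> = ?L * (\<Sum>K\<in>D. measure lborel K)" by (simp add: sum_distrib_left)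
    also have "\<dots> < e" using * by (simp add: field_simps)
    finally show "(\<Sum>K\<in>D. norm (f (Sup K) - f (Inf K))) < e" .
  qed (use e in simp)
qed

lemma absolutely_continuous_on_imp_continuous_on:
  fixes f :: "real \<Rightarrow> 'a::real_normed_vector"
  assumes ac: "absolutely_continuous_on {a..b} f"
  shows "continuous_on {a..b} f"
  unfolding continuous_on_iff
proof (intro ballI allI impI)
  fix x e :: real assume x: "x \<in> {a..b}" and e: "0 < e"
  obtain d where d: "d > 0" and D: "\<And>D U. D division_of U \<and> U \<subseteq> {a..b} \<and> (\<Sum>K\<in>D. measure lborel K) < d \<Longrightarrow>
        (\<Sum>K\<in>D. norm (f (Sup K) - f (Inf K))) < e"
    using ac[unfolded absolutely_continuous_on_def, rule_format, OF e] by blast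
  show "\<exists>d>0. \<forall>x'\<in>{a..b}. dist x' x < d \<longrightarrow> dist (f x') (f x) < e"
  proof (intro exI[of _ d] conjI ballI impI d)
    fix y assume y: "y \<in> {a..b}" "dist y x < d"
    let ?J = "cbox (min x y) (max x y)"
    have "{?J} division_of ?J" by (rule division_of_self) auto
    moreover have "?J \<subseteq> {a..b}" using x y by auto
    moreover have "(\<Sum>K\<in>{?J}. measure lborel K) < d"
      using y by (auto simp: dist_real_def abs_if min_def max_def split: if_splits)
    ultimately have "(\<Sum>K\<in>{?J}. norm (f (Sup K) - f (Inf K))) < e"
      using D[of "{?J}" ?J] by blast
    then show "dist (f y) (f x) < e"
      by (cases "x \<le> y") (auto simp: dist_norm norm_minus_commute min_def max_def)
  qed
qed

text \<open>The gauge puts intervals tagged in the exceptional null set inside an open set of small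
  measure, where absolute continuity takes over.\<close>

theorem absolutely_continuous_fundamental_theorem:
  fixes f :: "real \<Rightarrow> 'a::euclidean_space"
  assumes ab: "a \<le> b"
    and ac: "absolutely_continuous_on {a..b} f"
    and deriv: "AE t in lborel. t \<in> {a..b} \<longrightarrow> (f has_vector_derivative f' t) (at t within {a..b})"
  shows "(f' has_integral (f b - f a)) {a..b}"
proof -
  define N where "N = {t \<in> {a..b}. \<not> (f has_vector_derivative f' t) (at t within {a..b})}"
  obtain N' where N': "{t \<in> space lborel. \<not> (t \<in> {a..b} \<longrightarrow> (f has_vector_derivative f' t) (at t within {a..b}))} \<subseteq> N'"
      "emeasure lborel N' = 0" "N' \<in> sets lborel"
    using AE_E[OF deriv] by blast
  then have "negligible N'"
    by (simp add: negligible_iff_null_sets null_sets_completionI null_setsI)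
  then have N: "negligible N"
    by (rule negligible_subset) (use N'(1) in \<open>auto simp: N_def\<close>)
  \<comment> \<open>With value 0 on \<open>N\<close>, tags in \<open>N\<close> have no Riemann term
    and leave only increments of \<open>f\<close>, which absolute continuity controls. The spike
    rule restores \<open>f'\<close> at the end.\<close>
  define g where "g = (\<lambda>t. if t \<in> N then 0 else f' t)"
  have "(g has_integral (f b - f a)) (cbox a b)"
    unfolding has_integral
  proof (intro allI impI)
    fix e :: real assume e: "0 < e"
    \<comment> \<open>The extra 1 allows a = b and keeps e1 * (b - a) strictly below e / 2.\<close>
    define e1 where "e1 = e / (2 * (b - a + 1))"
    have e1: "0 < e1" using e ab by (simp add: e1_def)
    obtain \<delta> where \<delta>: "\<delta> > 0" and AC: "\<And>D U. D division_of U \<and> U \<subseteq> {a..b} \<and> (\<Sum>K\<in>D. measure lborel K) < \<delta> \<Longrightarrow>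
        (\<Sum>K\<in>D. norm (f (Sup K) - f (Inf K))) < e / 2"
      using ac[unfolded absolutely_continuous_on_def, rule_format, OF half_gt_zero[OF e]] by blast
    obtain U where "open U" "N \<subseteq> U" and UN: "U - N \<in> lmeasurable" "emeasure lebesgue (U - N) < ennreal \<delta>"
      using sets_lebesgue_outer_open[OF negligible_imp_sets[OF N] \<delta>] by blast
    have "measure lebesgue (U - N) < \<delta>"
      using UN \<delta> by (simp add: emeasure_eq_measure2 ennreal_less_iff)
    moreover have "U = (U - N) \<union> N" using \<open>N \<subseteq> U\<close> by blast
    moreover have "(U - N) \<union> N \<in> lmeasurable"
      by (rule fmeasurable.Un[OF UN(1) negligible_imp_measurable[OF N]])
    moreover have "measure lebesgue ((U - N) \<union> N) \<le> measure lebesgue (U - N) + measure lebesgue N"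
      using UN(1) negligible_imp_sets[OF N] by (intro measure_Un_le) auto
    ultimately have U: "open U" "N \<subseteq> U" "U \<in> lmeasurable" "measure lebesgue U < \<delta>"
      using negligible_imp_measure0[OF N] \<open>open U\<close> \<open>N \<subseteq> U\<close> by auto
    have "\<forall>x. \<exists>d>0. x \<in> {a..b} - N \<longrightarrow>
         (\<forall>y\<in>{a..b}. norm (y-x) < d \<longrightarrow> norm (f y - f x - (y-x) *\<^sub>R g x) \<le> e1 * norm (y-x))"
    proof
      fix x
      show "\<exists>d>0. x \<in> {a..b} - N \<longrightarrow>
         (\<forall>y\<in>{a..b}. norm (y-x) < d \<longrightarrow> norm (f y - f x - (y-x) *\<^sub>R g x) \<le> e1 * norm (y-x))"
      proof (cases "x \<in> {a..b} - N")
        case True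
        then have "(f has_vector_derivative f' x) (at x within {a..b})" by (auto simp: N_def)
        then show ?thesis
          using e1 True unfolding has_vector_derivative_def has_derivative_within_alt g_def by auto
      qed (auto intro: exI[of _ 1])
    qed
    then obtain d where d: "\<And>x. 0 < d x"
      "\<And>x y. \<lbrakk>x \<in> {a..b} - N; y \<in> {a..b}; norm (y-x) < d x\<rbrakk>
            \<Longrightarrow> norm (f y - f x - (y-x) *\<^sub>R g x) \<le> e1 * norm (y-x)"
      by metis
    define \<gamma> where "\<gamma> = (\<lambda>x. if x \<in> N then U else ball x (d x))"
    show "\<exists>\<gamma>. gauge \<gamma> \<and> (\<forall>\<D>. \<D> tagged_division_of cbox a b \<and> \<gamma> fine \<D> \<longrightarrow>
           norm ((\<Sum>(x,k)\<in>\<D>. measure lborel k *\<^sub>R g x) - (f b - f a)) < e)"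
    proof (intro exI[of _ \<gamma>] conjI allI impI)
      show "gauge \<gamma>" using U d(1) by (auto simp: gauge_def \<gamma>_def)
    next
      fix p assume p: "p tagged_division_of cbox a b \<and> \<gamma> fine p"
      then have ptag: "p tagged_division_of cbox a b" and fine: "\<gamma> fine p" by auto
      note pD = tagged_division_ofD[OF ptag]
      define p1 where "p1 = {(x,K) \<in> p. x \<in> N}"
      define p2 where "p2 = {(x,K) \<in> p. x \<notin> N}"
      have pp: "p = p1 \<union> p2" "p1 \<inter> p2 = {}" "p1 \<subseteq> p" "p2 \<subseteq> p" by (auto simp: p1_def p2_def)
      have fin: "finite p1" "finite p2" using pD(1) pp by (auto intro: finite_subset)
      have "f b - f a = (\<Sum>(x,K)\<in>p. f (Sup K) - f (Inf K))"
        using additive_tagged_division_1[OF ab, of p f] ptag by simp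
      then have split: "(\<Sum>(x,k)\<in>p. measure lborel k *\<^sub>R g x) - (f b - f a)
          = (\<Sum>(x,K)\<in>p1. measure lborel K *\<^sub>R g x - (f (Sup K) - f (Inf K)))
          + (\<Sum>(x,K)\<in>p2. measure lborel K *\<^sub>R g x - (f (Sup K) - f (Inf K)))"
        using sum.union_disjoint[OF fin pp(2), of "\<lambda>(x,K). measure lborel K *\<^sub>R g x - (f (Sup K) - f (Inf K))"]
        by (simp add: pp(1)[symmetric] sum_subtractf split_def)
      have p1tag: "p1 tagged_partial_division_of cbox a b"
        using ptag pp(3) by (meson tagged_division_of_def tagged_partial_division_subset)
      let ?D = "snd ` p1"
      have Ddiv: "?D division_of \<Union>?D" by (rule partial_division_of_tagged_division[OF p1tag])
      have Dsub: "\<Union>?D \<subseteq> {a..b}" using pD(3) pp(3) by force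
      have "(\<Sum>K\<in>?D. measure lborel K) = (\<Sum>K\<in>?D. measure lebesgue K)"
        using division_ofD(4)[OF Ddiv] by (intro sum.cong refl) fastforce
      also have "\<dots> = measure lebesgue (\<Union>?D)" by (rule content_division[OF Ddiv])
      also have "\<dots> \<le> measure lebesgue U"
      proof (rule measure_mono_fmeasurable)
        show "\<Union>?D \<subseteq> U" using fine by (fastforce simp: fine_def p1_def \<gamma>_def)
        show "\<Union>?D \<in> sets lebesgue" using lmeasurable_division[OF Ddiv] by auto
      qed (rule U)
      finally have small: "(\<Sum>K\<in>?D. norm (f (Sup K) - f (Inf K))) < e / 2"
        using U Ddiv Dsub AC[of ?D "\<Union>?D"] by linarith
      have "norm (\<Sum>(x,K)\<in>p1. measure lborel K *\<^sub>R g x - (f (Sup K) - f (Inf K)))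
          \<le> (\<Sum>(x,K)\<in>p1. norm (f (Sup K) - f (Inf K)))"
        by (rule sum_norm_le) (auto simp: p1_def g_def norm_minus_commute)
      \<comment> \<open>Forgetting the tags can identify degenerate intervals, so the summand has to
        vanish on all of these. Singletons comply by themselves; the empty interval needs an
        explicit 0, as \<open>Sup {}\<close> and \<open>Inf {}\<close> are arbitrary values.
        Intervals in \<open>p1\<close> contain their tag, so nothing changes here.\<close>
      also have "\<dots> = (\<Sum>(x,K)\<in>p1. if K = {} then 0 else norm (f (Sup K) - f (Inf K)))"
        using tagged_partial_division_ofD(2)[OF p1tag] by (intro sum.cong refl) fastforce
      also have "\<dots> = (\<Sum>K\<in>?D. if K = {} then 0 else norm (f (Sup K) - f (Inf K)))"
      proof (rule sum.over_tagged_division_lemma[OF tagged_partial_division_of_Union_self[OF p1tag]])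
        fix u v :: real assume "box u v = {}"
        then show "(if cbox u v = {} then 0 else norm (f (Sup (cbox u v)) - f (Inf (cbox u v)))) = 0"
          by (cases "u = v") auto
      qed
      also have "\<dots> \<le> (\<Sum>K\<in>?D. norm (f (Sup K) - f (Inf K)))"
        by (rule sum_mono) auto
      finally have n1: "norm (\<Sum>(x,K)\<in>p1. measure lborel K *\<^sub>R g x - (f (Sup K) - f (Inf K))) < e / 2"
        using small by linarith
      have "norm (\<Sum>(x,K)\<in>p2. measure lborel K *\<^sub>R g x - (f (Sup K) - f (Inf K)))
         \<le> (\<Sum>n\<in>p2. e1 * (case n of (x,K) \<Rightarrow> measure lborel K))"
      proof (rule sum_norm_le, safe)
        fix x K assume xK: "(x,K) \<in> p2"
        then have xp: "(x,K) \<in> p" and xN: "x \<notin> N" by (auto simp: p2_def)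
        obtain u v where k: "K = cbox u v" using pD(4)[OF xp] by blast
        have xin: "x \<in> K" and kab: "K \<subseteq> cbox a b" using pD(2,3)[OF xp] by auto
        have uv: "u \<le> v" using xin by (auto simp: k)
        have ball: "K \<subseteq> ball x (d x)" using bspec[OF fine[unfolded fine_def] xp] xN by (simp add: \<gamma>_def)
        have "u \<in> K" "v \<in> K" using uv by (auto simp: k)
        \<comment> \<open>Straddle estimate: both ends are compared with the tag \<open>x\<close>
          between them, so the two errors add up to a multiple of v - u.\<close>
        have "norm ((v - u) *\<^sub>R g x - (f v - f u)) = norm (f u - f x - (u - x) *\<^sub>R g x - (f v - f x - (v - x) *\<^sub>R g x))"
          by (auto simp: algebra_simps)
        also have "\<dots> \<le> norm (f u - f x - (u - x) *\<^sub>R g x) + norm (f v - f x - (v - x) *\<^sub>R g x)"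
          by (rule norm_triangle_ineq4)
        also have "\<dots> \<le> e1 * norm (u - x) + e1 * norm (v - x)"
        proof (rule add_mono; rule d(2))
          show "norm (u - x) < d x" "norm (v - x) < d x"
            using \<open>u \<in> K\<close> \<open>v \<in> K\<close> ball by (auto simp: dist_real_def subset_iff)
        qed (use xin xN kab \<open>u \<in> K\<close> \<open>v \<in> K\<close> in auto)
        also have "\<dots> = e1 * (v - u)"
          using xin by (auto simp: k algebra_simps)
        finally show "norm (measure lborel K *\<^sub>R g x - (f (Sup K) - f (Inf K))) \<le> e1 * measure lborel K"
          using uv by (simp add: k)
      qed
      also have "\<dots> \<le> (\<Sum>n\<in>p. e1 * (case n of (x,K) \<Rightarrow> measure lborel K))"
        using pp(4) pD(1) e1 by (intro sum_mono2) auto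
      also have "\<dots> = e1 * (b - a)"
        using additive_content_tagged_division[OF ptag] ab by (simp add: sum_distrib_left[symmetric])
      also have "\<dots> < e / 2"
        using e ab by (simp add: e1_def field_simps)
      finally have n2: "norm (\<Sum>(x,K)\<in>p2. measure lborel K *\<^sub>R g x - (f (Sup K) - f (Inf K))) < e / 2" .
      show "norm ((\<Sum>(x,k)\<in>p. measure lborel k *\<^sub>R g x) - (f b - f a)) < e"
        unfolding split using n1 n2 by (intro norm_triangle_lt) simp
    qed
  qed
  then have "(f' has_integral (f b - f a)) (cbox a b)"
    by (rule has_integral_spike[OF N, rotated]) (auto simp: g_def)
  then show ?thesis by simp
qed

section \<open>Linear equations with bounded measurable coefficients\<close>

lemma borel_measurable_vecI:
  fixes f :: "'a \<Rightarrow> real ^ 'n"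
  assumes "\<And>i. (\<lambda>x. f x $ i) \<in> borel_measurable M"
  shows "f \<in> borel_measurable M"
  using assms by (subst borel_measurable_euclidean_space) (auto simp: Basis_vec_def inner_axis)

text \<open>In integral form, shifts and linear combinations of solutions need no null sets and no absolute
  continuity.\<close>

definition integral_solution ::
  "(real \<Rightarrow> real ^ 'n ^ 'n) \<Rightarrow> real ^ 'n \<Rightarrow> (real \<Rightarrow> real ^ 'n::finite) \<Rightarrow> bool" where
  "integral_solution B p u \<longleftrightarrow> continuous_on {0..} u \<and>
     (\<forall>t\<ge>0. ((\<lambda>s. B s *v u s) has_integral (u t - p)) {0..t})"

text \<open>The initial condition is contained in the integral equation at time 0.\<close>

lemma integral_solution_0:
  assumes "integral_solution B p u" shows "u 0 = p"
proof -
  have "((\<lambda>s. B s *v u s) has_integral (u 0 - p)) {0..0}"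
    using assms by (auto simp: integral_solution_def)
  moreover have "((\<lambda>s. B s *v u s) has_integral 0) {0..0}"
    using has_integral_refl(1)[of "\<lambda>s. B s *v u s" "0::real"] by (simp only: box_real)
  ultimately have "u 0 - p = 0" by (rule has_integral_unique)
  then show ?thesis by simp
qed

lemma has_integral_diff_Icc:
  fixes f :: "real \<Rightarrow> 'a::banach"
  assumes F: "\<And>t. 0 \<le> t \<Longrightarrow> (f has_integral F t) {0..t}" and ab: "0 \<le> a" "a \<le> b"
  shows "(f has_integral (F b - F a)) {a..b}"
proof -
  have a: "(f has_integral F a) {0..a}" and b: "(f has_integral F b) {0..b}"
    using F ab by auto
  have "f integrable_on {a..b}"
    using ab by (intro integrable_on_subinterval[OF has_integral_integrable[OF b]]) auto
  then obtain i where i: "(f has_integral i) {a..b}" by (auto simp: integrable_on_def)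
  have "(f has_integral (F a + i)) {0..b}"
    using ab by (intro has_integral_combine[OF _ _ a i]) auto
  from has_integral_unique[OF this b] have "i = F b - F a" by (simp add: algebra_simps)
  with i show ?thesis by simp
qed

lemma integral_solution_Icc:
  assumes u: "integral_solution B p u" and ab: "0 \<le> a" "a \<le> b"
  shows "((\<lambda>s. B s *v u s) has_integral (u b - u a)) {a..b}"
  using has_integral_diff_Icc[of "\<lambda>s. B s *v u s" "\<lambda>t. u t - p", OF _ ab] u
  by (simp add: integral_solution_def)

lemma integral_solution_shift:
  assumes u: "integral_solution B p u" and t: "0 \<le> t"
  shows "integral_solution (\<lambda>s. B (s + t)) (u t) (\<lambda>s. u (s + t))"
  unfolding integral_solution_def
proof (intro conjI allI impI)
  show "continuous_on {0..} (\<lambda>s. u (s + t))"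
  proof (rule continuous_on_compose2[of "{0..}" u])
    show "continuous_on {0..} u" using u by (simp add: integral_solution_def)
    show "continuous_on {0..} (\<lambda>s. s + t)" by (intro continuous_intros)
    show "(\<lambda>s. s + t) ` {0..} \<subseteq> {0..}" using t by auto
  qed
  fix r :: real assume "0 \<le> r"
  then have "((\<lambda>s. B s *v u s) has_integral (u (r + t) - u t)) {t..r + t}"
    using t by (intro integral_solution_Icc[OF u]) auto
  from has_integral_shift_real_ivl[OF this, of t]
  show "((\<lambda>s. B (s + t) *v u (s + t)) has_integral (u (r + t) - u t)) {0..r}" by simp
qed

lemma integral_solution_linear:
  assumes "integral_solution B p u" "integral_solution B q v"
  shows "integral_solution B (a *\<^sub>R p + b *\<^sub>R q) (\<lambda>t. a *\<^sub>R u t + b *\<^sub>R v t)"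
  unfolding integral_solution_def
proof (intro conjI allI impI)
  show "continuous_on {0..} (\<lambda>t. a *\<^sub>R u t + b *\<^sub>R v t)"
    using assms by (auto simp: integral_solution_def intro!: continuous_intros)
  fix t :: real assume "0 \<le> t"
  then have "((\<lambda>s. a *\<^sub>R (B s *v u s) + b *\<^sub>R (B s *v v s)) has_integral (a *\<^sub>R (u t - p) + b *\<^sub>R (v t - q))) {0..t}"
    using assms by (intro has_integral_add has_integral_cmul) (auto simp: integral_solution_def)
  then show "((\<lambda>s. B s *v (a *\<^sub>R u s + b *\<^sub>R v s)) has_integral
      (a *\<^sub>R u t + b *\<^sub>R v t - (a *\<^sub>R p + b *\<^sub>R q))) {0..t}"
    by (simp add: matrix_vector_right_distrib matrix_vector_mult_scaleR algebra_simps)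
qed

text \<open>The terms of the Peano-Baker series. The Lebesgue integral is chosen because it
  preserves measurability in parameters; \<open>picard_term_integral_aux\<close> identifies it with
  the gauge integral of the integral equation.\<close>

primrec picard_term :: "(real \<Rightarrow> real ^ 'n ^ 'n) \<Rightarrow> real ^ 'n::finite \<Rightarrow> nat \<Rightarrow> real \<Rightarrow> real ^ 'n" where
  "picard_term B p 0 t = p"
| "picard_term B p (Suc k) t = (LINT s:{0..t}|lborel. B s *v picard_term B p k s)"

definition picard_solution :: "(real \<Rightarrow> real ^ 'n ^ 'n) \<Rightarrow> real ^ 'n::finite \<Rightarrow> real \<Rightarrow> real ^ 'n" where
  "picard_solution B p t = (\<Sum>k. picard_term B p k t)"

text \<open>Joint measurability is what the induction can carry: the next term integrates the
  previous one over time.\<close>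

lemma picard_term_measurable:
  fixes B :: "'w \<Rightarrow> real \<Rightarrow> real ^ 'n::finite ^ 'n"
  assumes B: "\<And>i j. (\<lambda>(s, w). B w s $ i $ j) \<in> borel_measurable (borel \<Otimes>\<^sub>M M)"
  shows "(\<lambda>(t, w). picard_term (B w) p k t) \<in> borel_measurable (borel \<Otimes>\<^sub>M M)"
proof (induction k)
  case (Suc k)
  \<comment> \<open>Points are ((t, w), s) with integration variable s. The indicator of {0..t} in s
    moves the variable upper limit into the integrand.\<close>
  let ?N = "(borel \<Otimes>\<^sub>M M) \<Otimes>\<^sub>M (lborel :: real measure)"
  have m: "(\<lambda>z. (snd z, snd (fst z))) \<in> ?N \<rightarrow>\<^sub>M borel \<Otimes>\<^sub>M M"
    by simp
  have Bm: "(\<lambda>z. B (snd (fst z)) (snd z) $ i $ j) \<in> borel_measurable ?N" for i j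
    using measurable_compose[OF m B[of i j]] by (simp add: split_def)
  have "(\<lambda>z. picard_term (B (snd (fst z))) p k (snd z)) \<in> borel_measurable ?N"
    using measurable_compose[OF m Suc.IH] by (simp add: split_def)
  then have Pm: "(\<lambda>z. picard_term (B (snd (fst z))) p k (snd z) $ j) \<in> borel_measurable ?N" for j
    by (rule borel_measurable_continuous_on[OF continuous_on_component[OF continuous_on_id]])
  have "(\<lambda>z. B (snd (fst z)) (snd z) *v picard_term (B (snd (fst z))) p k (snd z)) \<in> borel_measurable ?N"
    by (intro borel_measurable_vecI)
       (auto simp: matrix_vector_mult_def intro!: borel_measurable_sum borel_measurable_times Bm Pm)
  moreover have "(\<lambda>z. indicat_real {0..fst (fst z)} (snd z)) \<in> borel_measurable ?N"
  proof -
    have "(\<lambda>z. indicat_real {0..fst (fst z)} (snd z)) = (\<lambda>z::(real \<times> 'w) \<times> real. if 0 \<le> snd z \<and> snd z \<le> fst (fst z) then 1 else 0)"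
      by (auto simp: fun_eq_iff indicator_def)
    then show ?thesis by (auto intro!: measurable_If)
  qed
  ultimately have "(\<lambda>z. indicat_real {0..fst (fst z)} (snd z) *\<^sub>R
      (B (snd (fst z)) (snd z) *v picard_term (B (snd (fst z))) p k (snd z))) \<in> borel_measurable ?N"
    by (rule borel_measurable_scaleR[rotated])
  then have "(\<lambda>(x, s). indicat_real {0..fst x} s *\<^sub>R (B (snd x) s *v picard_term (B (snd x)) p k s)) \<in> borel_measurable ?N"
    by (simp add: split_def)
  from lborel.borel_measurable_lebesgue_integral[OF this]
  show ?case by (simp add: set_lebesgue_integral_def split_def)
qed simp

lemma picard_solution_measurable:
  fixes B :: "'w \<Rightarrow> real \<Rightarrow> real ^ 'n::finite ^ 'n"
  assumes B: "\<And>i j. (\<lambda>(s, w). B w s $ i $ j) \<in> borel_measurable (borel \<Otimes>\<^sub>M M)"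
  shows "(\<lambda>w. picard_solution (B w) p t) \<in> borel_measurable M"
proof -
  have "(\<lambda>w. picard_term (B w) p k t) \<in> borel_measurable M" for k
    using measurable_compose[OF measurable_Pair1' picard_term_measurable[OF B, of p k], of t] by simp
  then show ?thesis
    unfolding picard_solution_def by (rule borel_measurable_suminf)
qed

section \<open>Existence and uniqueness for a bounded measurable coefficient matrix\<close>

locale bounded_matrix_path =
  fixes B :: "real \<Rightarrow> real ^ 'n::finite ^ 'n" and L :: real
  assumes meas: "\<And>i j. (\<lambda>s. B s $ i $ j) \<in> borel_measurable borel"
    and bound: "\<And>s x. norm (B s *v x) \<le> L * norm x"
    and L_nonneg: "0 \<le> L"
begin

text \<open>One application of the integral operator raises the order of the exponential-series
  bound by one. It drives both uniqueness and convergence of the Picard series.\<close>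

lemma integral_bound_power:
  assumes I: "((\<lambda>s. B s *v f s) has_integral I) {0..t}" and t: "0 \<le> t"
    and f: "\<And>s. 0 \<le> s \<Longrightarrow> s \<le> t \<Longrightarrow> norm (f s) \<le> c * ((L * s) ^ k / fact k)"
  shows "norm I \<le> c * ((L * t) ^ Suc k / fact (Suc k))"
proof -
  let ?g = "\<lambda>s. c * ((L * s) ^ Suc k / fact (Suc k))"
  have g: "((\<lambda>s. L * (c * ((L * s) ^ k / fact k))) has_integral (?g t - ?g 0)) {0..t}"
  proof (rule fundamental_theorem_of_calculus[OF t])
    fix x
    have "((\<lambda>s. L * s) has_real_derivative L) (at x within {0..t})"
      by (auto intro!: derivative_eq_intros)
    from DERIV_cmult[OF DERIV_cdivide[OF DERIV_power_Suc[OF this, of k], of "fact (Suc k)"], of c]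
    have "(?g has_real_derivative c * ((1 + real k) * (L * (L * x) ^ k) / fact (Suc k))) (at x within {0..t})" .
    moreover have "c * ((1 + real k) * (L * (L * x) ^ k) / fact (Suc k)) = L * (c * ((L * x) ^ k / fact k))"
    proof -
      have "fact (Suc k) = (1 + real k) * fact k" by simp
      moreover have "1 + real k \<noteq> 0" by linarith
      ultimately show ?thesis by (simp del: fact_Suc)
    qed
    ultimately have "(?g has_real_derivative (L * (c * ((L * x) ^ k / fact k)))) (at x within {0..t})"
      by (simp only:)
    then show "(?g has_vector_derivative (L * (c * ((L * x) ^ k / fact k)))) (at x within {0..t})"
      by (simp add: has_real_derivative_iff_has_vector_derivative)
  qed
  have b: "norm (B s *v f s) \<le> L * (c * ((L * s) ^ k / fact k))" if "s \<in> {0..t}" for s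
    using order_trans[OF bound mult_left_mono[OF f L_nonneg]] that by auto
  have "norm (integral {0..t} (\<lambda>s. B s *v f s)) \<le> integral {0..t} (\<lambda>s. L * (c * ((L * s) ^ k / fact k)))"
    by (rule integral_norm_bound_integral[OF has_integral_integrable[OF I] has_integral_integrable[OF g] b])
  then have "norm I \<le> ?g t - ?g 0"
    unfolding integral_unique[OF I] integral_unique[OF g] .
  then show ?thesis by simp
qed

text \<open>Iteration in place of Gronwall: the difference is a fixed point of the integral
  operator, hence bounded by the k-th term of an exponential series for every k.\<close>

lemma integral_solution_unique:
  assumes u: "integral_solution B p u" and v: "integral_solution B p v" and t: "0 \<le> t"
  shows "u t = v t"
proof -
  define w where "w = (\<lambda>t. u t - v t)"
  have w: "integral_solution B 0 w"
    using integral_solution_linear[OF u v, of 1 "-1"] by (simp add: w_def)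
  then have wint: "((\<lambda>s. B s *v w s) has_integral w s) {0..s}" if "0 \<le> s" for s
    using that by (auto simp: integral_solution_def)
  have "continuous_on {0..t} w"
    using w by (auto simp: integral_solution_def intro: continuous_on_subset)
  then have "bounded (w ` {0..t})"
    by (intro compact_imp_bounded compact_continuous_image) auto
  then obtain c where c: "\<And>s. s \<in> {0..t} \<Longrightarrow> norm (w s) \<le> c"
    unfolding bounded_iff by blast
  have "norm (w s) \<le> c * ((L * s) ^ k / fact k)" if "0 \<le> s" "s \<le> t" for s k
    using that
  proof (induction k arbitrary: s)
    case 0 then show ?case using c by simp
  next
    case (Suc k)
    show ?case by (rule integral_bound_power[OF wint]) (use Suc in auto)
  qed
  then have "norm (w t) \<le> c * ((L * t) ^ k / fact k)" for k using t by simp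
  moreover have "(\<lambda>k. c * ((L * t) ^ k / fact k)) \<longlonglongrightarrow> c * 0"
    using summable_LIMSEQ_zero[OF summable_exp[of "L * t"]]
    by (intro tendsto_mult tendsto_const) (simp add: divide_inverse mult.commute)
  ultimately have "norm (w t) \<le> 0"
    using LIMSEQ_le_const[of "\<lambda>k. c * ((L * t) ^ k / fact k)" "c * 0" "norm (w t)"] by simp
  then show ?thesis by (simp add: w_def)
qed

lemma mult_measurable:
  assumes f: "f \<in> borel_measurable borel"
  shows "(\<lambda>s. B s *v f s) \<in> borel_measurable borel"
proof -
  have "(\<lambda>z. f z $ j) \<in> borel_measurable borel" for j
    by (rule borel_measurable_continuous_on[OF continuous_on_component[OF continuous_on_id] f])
  then show ?thesis
    by (intro borel_measurable_vecI)
       (auto simp: matrix_vector_mult_def intro!: borel_measurable_sum borel_measurable_times meas)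
qed

lemma mult_set_integrable:
  assumes f: "f \<in> borel_measurable borel" and b: "\<And>s. s \<in> {a..b} \<Longrightarrow> norm (f s) \<le> c"
  shows "set_integrable lborel {a..b} (\<lambda>s. B s *v f s)"
  unfolding set_integrable_def
proof (rule integrableI_bounded_set_indicator)
  show "AE s in lborel. s \<in> {a..b} \<longrightarrow> norm (B s *v f s) \<le> L * c"
    using order_trans[OF bound mult_left_mono[OF b L_nonneg]] by auto
qed (use mult_measurable[OF f] in \<open>auto simp: emeasure_lborel_Icc_eq\<close>)

lemma picard_term_meas: "picard_term B p k \<in> borel_measurable borel"
proof -
  \<comment> \<open>A one-point parameter space specialises the joint statement to a single
    path.\<close>
  let ?M = "count_space (UNIV :: unit set)"
  have "(\<lambda>(s, w::unit). B s $ i $ j) \<in> borel_measurable (borel \<Otimes>\<^sub>M ?M)" for i j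
    using measurable_compose[OF measurable_fst meas[of i j]] by (simp add: split_def)
  then have "(\<lambda>(t, w::unit). picard_term B p k t) \<in> borel_measurable (borel \<Otimes>\<^sub>M ?M)"
    by (rule picard_term_measurable)
  from measurable_compose[OF measurable_Pair2'[of "()"] this] show ?thesis by simp
qed

text \<open>The bound on the previous term is a premise because the bound and the integral equation
  for the terms depend on each other; \<open>picard_term_bound\<close> supplies it inside its own
  induction.\<close>

lemma picard_term_integral_aux:
  assumes "0 \<le> t" and "\<And>s. s \<in> {0..t} \<Longrightarrow> norm (picard_term B p k s) \<le> c"
  shows "((\<lambda>s. B s *v picard_term B p k s) has_integral picard_term B p (Suc k) t) {0..t}"
proof -
  have *: "set_integrable lborel {0..t} (\<lambda>s. B s *v picard_term B p k s)"
    by (rule mult_set_integrable[OF picard_term_meas assms(2)])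
  show ?thesis
    unfolding picard_term.simps(2)[of B p k t] set_borel_integral_eq_integral(2)[OF *]
    by (rule integrable_integral[OF set_borel_integral_eq_integral(1)[OF *]])
qed

lemma picard_term_bound:
  "0 \<le> t \<Longrightarrow> norm (picard_term B p k t) \<le> norm p * ((L * t) ^ k / fact k)"
proof (induction k arbitrary: t)
  case (Suc k)
  have "((\<lambda>s. B s *v picard_term B p k s) has_integral picard_term B p (Suc k) t) {0..t}"
  proof (rule picard_term_integral_aux[OF Suc.prems])
    fix s assume s: "s \<in> {0..t}"
    then have "norm (picard_term B p k s) \<le> norm p * ((L * s) ^ k / fact k)"
      using Suc.IH by simp
    also have "\<dots> \<le> norm p * ((L * t) ^ k / fact k)"
      using s L_nonneg by (intro mult_left_mono divide_right_mono power_mono) auto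
    finally show "norm (picard_term B p k s) \<le> norm p * ((L * t) ^ k / fact k)" .
  qed
  then show ?case by (rule integral_bound_power) (use Suc in auto)
qed simp

lemma picard_term_integral:
  assumes t: "0 \<le> t"
  shows "((\<lambda>s. B s *v picard_term B p k s) has_integral picard_term B p (Suc k) t) {0..t}"
proof (rule picard_term_integral_aux[OF t])
  fix s assume s: "s \<in> {0..t}"
  then have "norm (picard_term B p k s) \<le> norm p * ((L * s) ^ k / fact k)"
    by (intro picard_term_bound) simp
  also have "\<dots> \<le> norm p * ((L * t) ^ k / fact k)"
    using s L_nonneg by (intro mult_left_mono divide_right_mono power_mono) auto
  finally show "norm (picard_term B p k s) \<le> norm p * ((L * t) ^ k / fact k)" .
qed

lemma picard_term_sums:
  assumes t: "0 \<le> t"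
  shows "(\<lambda>k. picard_term B p k t) sums picard_solution B p t"
proof -
  have s: "summable (\<lambda>k. norm p * ((L * t) ^ k / fact k))"
    using summable_exp[of "L * t"] by (intro summable_mult) (simp add: field_simps)
  have "summable (\<lambda>k. picard_term B p k t)"
    by (rule summable_comparison_test'[OF s]) (use picard_term_bound[OF t] in auto)
  then show ?thesis unfolding picard_solution_def by (rule summable_sums)
qed

lemma picard_partial_bound:
  assumes t: "0 \<le> t"
  shows "norm (\<Sum>k<n. picard_term B p k t) \<le> norm p * exp (L * t)"
proof -
  have ex: "(\<lambda>k. (L * t) ^ k / fact k) sums exp (L * t)"
    using exp_converges[of "L * t"] by (simp add: field_simps)
  have "norm (\<Sum>k<n. picard_term B p k t) \<le> (\<Sum>k<n. norm p * ((L * t) ^ k / fact k))"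
    using picard_term_bound[OF t] by (intro sum_norm_le) auto
  also have "\<dots> = norm p * (\<Sum>k<n. (L * t) ^ k / fact k)" by (simp add: sum_distrib_left)
  also have "\<dots> \<le> norm p * exp (L * t)"
    using sum_le_suminf[OF sums_summable[OF ex], of "{..<n}"] sums_unique[OF ex] t L_nonneg
    by (intro mult_left_mono) auto
  finally show ?thesis .
qed

lemma picard_solution_bound:
  assumes t: "0 \<le> t"
  shows "norm (picard_solution B p t) \<le> norm p * exp (L * t)"
proof (rule LIMSEQ_le_const2)
  show "(\<lambda>n. norm (\<Sum>k<n. picard_term B p k t)) \<longlonglongrightarrow> norm (picard_solution B p t)"
    using picard_term_sums[OF t] by (intro tendsto_norm) (simp add: sums_def)
qed (use picard_partial_bound[OF t] in auto)

text \<open>Integrating the k-th term gives the term Suc k, so the integrated partial sums converge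
  to the series without its first term \<open>p\<close>. Dominated convergence, with
  \<open>picard_partial_bound\<close> as majorant, moves the limit inside.\<close>

lemma picard_solution_integral:
  assumes t: "0 \<le> t"
  shows "((\<lambda>s. B s *v picard_solution B p s) has_integral (picard_solution B p t - p)) {0..t}"
proof -
  let ?f = "\<lambda>n s. B s *v (\<Sum>k<n. picard_term B p k s)"
  let ?g = "\<lambda>s. B s *v picard_solution B p s"
  have f: "(?f n has_integral (\<Sum>k<n. picard_term B p (Suc k) t)) {0..t}" for n
    unfolding linear_sum[OF matrix_vector_mul_linear]
    by (intro has_integral_sum) (use picard_term_integral[OF t] in auto)
  have lim: "(\<lambda>n. ?f n s) \<longlonglongrightarrow> ?g s" if "s \<in> {0..t}" for s
    using picard_term_sums[of s p] that
    by (intro bounded_linear.tendsto[OF matrix_vector_mul_bounded_linear]) (auto simp: sums_def)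
  have "norm (?f n s) \<le> L * (norm p * exp (L * t))" if s: "s \<in> {0..t}" for n s
  proof -
    have "norm (?f n s) \<le> L * (norm p * exp (L * s))"
      using order_trans[OF bound mult_left_mono[OF picard_partial_bound L_nonneg]] s by auto
    also have "\<dots> \<le> L * (norm p * exp (L * t))"
      using s L_nonneg by (intro mult_left_mono) (auto intro: mult_left_mono)
    finally show ?thesis .
  qed
  note dc = dominated_convergence[OF has_integral_integrable[OF f] integrable_const_ivl this lim]
  have "(\<lambda>n. \<Sum>k<n. picard_term B p (Suc k) t) \<longlonglongrightarrow> integral {0..t} ?g"
    using dc(2) f by (simp add: integral_unique[OF f])
  moreover have "(\<lambda>n. \<Sum>k<n. picard_term B p (Suc k) t) \<longlonglongrightarrow> picard_solution B p t - p"
  proof -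
    have "(\<lambda>k. picard_term B p (Suc k) t) sums (picard_solution B p t - p)"
      using sums_Suc_iff[of "\<lambda>k. picard_term B p k t" "picard_solution B p t - p"]
        picard_term_sums[OF t, of p] by (simp del: picard_term.simps(2))
    then show ?thesis by (simp only: sums_def)
  qed
  ultimately have "integral {0..t} ?g = picard_solution B p t - p" by (rule LIMSEQ_unique)
  with integrable_integral[OF dc(1)] show ?thesis by simp
qed

lemma picard_solution_lipschitz:
  assumes "0 \<le> a" "a \<le> b" "b \<le> T"
  shows "norm (picard_solution B p b - picard_solution B p a) \<le> L * (norm p * exp (L * T)) * (b - a)"
proof -
  let ?g = "\<lambda>s. B s *v picard_solution B p s"
  have hi: "(?g has_integral (picard_solution B p b - picard_solution B p a)) {a..b}"
    using has_integral_diff_Icc[of ?g "\<lambda>t. picard_solution B p t - p", OF picard_solution_integral assms(1,2)]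
    by simp
  have "norm (picard_solution B p b - picard_solution B p a) \<le> L * (norm p * exp (L * T)) * measure lborel {a..b}"
  proof (rule has_integral_bound_real[OF _ finite.emptyI hi])
    show "0 \<le> L * (norm p * exp (L * T))" using L_nonneg by simp
    fix s assume "s \<in> {a..b} - {}"
    then have s: "s \<in> {a..b}" by simp
    have "norm (?g s) \<le> L * (norm p * exp (L * s))"
      using order_trans[OF bound mult_left_mono[OF picard_solution_bound L_nonneg]] s assms by auto
    also have "\<dots> \<le> L * (norm p * exp (L * T))"
      using s L_nonneg assms by (intro mult_left_mono) (auto intro: mult_left_mono)
    finally show "norm (?g s) \<le> L * (norm p * exp (L * T))" .
  qed
  then show ?thesis using assms by simp
qed

lemma picard_integral_solution: "integral_solution B p (picard_solution B p)"
  unfolding integral_solution_def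
proof (intro conjI allI impI picard_solution_integral)
  show "continuous_on {0..} (picard_solution B p)"
    unfolding continuous_on_def
  proof
    fix x :: real assume x: "x \<in> {0..}"
    define K where "K = L * (norm p * exp (L * (x + 1)))"
    have "norm (picard_solution B p y - picard_solution B p x) \<le> K * \<bar>y - x\<bar>"
      if "y \<in> {0..}" "dist y x < 1" for y
    proof (cases "x \<le> y")
      case True
      then show ?thesis using picard_solution_lipschitz[of x y "x + 1" p] x that
        by (auto simp: K_def dist_real_def)
    next
      case False
      then show ?thesis using picard_solution_lipschitz[of y x "x + 1" p] x that
        by (auto simp: K_def dist_real_def norm_minus_commute)
    qed
    then have ev: "\<forall>\<^sub>F y in at x within {0..}.
        norm (picard_solution B p y - picard_solution B p x) \<le> K * \<bar>y - x\<bar>"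
      unfolding eventually_at by (intro exI[of _ 1]) auto
    have "((\<lambda>y. K * \<bar>y - x\<bar>) \<longlongrightarrow> K * \<bar>x - x\<bar>) (at x within {0..})"
      by (intro tendsto_intros)
    then have "((\<lambda>y. K * \<bar>y - x\<bar>) \<longlongrightarrow> 0) (at x within {0..})" by simp
    from Lim_null_comparison[OF ev this]
    show "(picard_solution B p \<longlongrightarrow> picard_solution B p x) (at x within {0..})"
      by (rule LIM_zero_cancel)
  qed
qed

lemma picard_solution_nonneg:
  assumes B: "\<And>s i j. 0 \<le> B s $ i $ j" and p: "\<And>i. 0 \<le> p $ i" and t: "0 \<le> t"
  shows "0 \<le> picard_solution B p t $ i"
proof -
  have nonneg: "0 \<le> picard_term B p k t $ i" if "0 \<le> t" for k t i
    using that
  proof (induction k arbitrary: t i)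
    case (Suc k)
    have "((\<lambda>s. (B s *v picard_term B p k s) $ i) has_integral picard_term B p (Suc k) t $ i) {0..t}"
      using has_integral_linear[OF picard_term_integral[OF Suc.prems] bounded_linear_vec_nth]
      by (simp add: o_def)
    then show ?case
      by (rule has_integral_nonneg) (auto simp: matrix_vector_mult_def intro!: sum_nonneg mult_nonneg_nonneg B Suc.IH)
  qed (use p in simp)
  have "(\<lambda>k. picard_term B p k t $ i) sums (picard_solution B p t $ i)"
    using bounded_linear.sums[OF bounded_linear_vec_nth picard_term_sums[OF t]] .
  from sums_le[OF nonneg[OF t] sums_zero this] show ?thesis .
qed

end

section \<open>Caratheodory solutions and the integral equation\<close>

lemma at_within_Icc_eq_Ici: "0 \<le> (x::real) \<Longrightarrow> x < b \<Longrightarrow> at x within {0..b} = at x within {0..}"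
  by (rule at_within_nhd[of _ "{..<b}"]) auto

lemma caratheodory_imp_integral_solution:
  fixes u :: "real \<Rightarrow> real ^ 'n::finite"
  assumes "caratheodory_solution A p u"
  shows "integral_solution A p u"
  unfolding integral_solution_def
proof (intro conjI allI impI)
  have u0: "u 0 = p" and ac: "\<And>T. 0 \<le> T \<Longrightarrow> absolutely_continuous_on {0..T} u"
    and ae: "AE t in lborel. 0 \<le> t \<longrightarrow> (u has_vector_derivative A t *v u t) (at t within {0..})"
    using assms by (auto simp: caratheodory_solution_def)
  show "continuous_on {0..} u"
    unfolding continuous_on_eq_continuous_within
  proof
    fix x :: real assume x: "x \<in> {0..}"
    then have "continuous_on {0..x + 1} u"
      by (intro absolutely_continuous_on_imp_continuous_on ac) simp
    then have "continuous (at x within {0..x + 1}) u"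
      using x by (simp add: continuous_on_eq_continuous_within)
    then show "continuous (at x within {0..}) u"
      using x at_within_Icc_eq_Ici[of x "x + 1"] by simp
  qed
  fix t :: real assume t: "0 \<le> t"
  have "AE s in lborel. s \<in> {0..t} \<longrightarrow> (u has_vector_derivative A s *v u s) (at s within {0..t})"
    using ae
  proof (rule AE_mp, intro AE_I2 impI)
    fix s assume h: "0 \<le> s \<longrightarrow> (u has_vector_derivative A s *v u s) (at s within {0..})" and s: "s \<in> {0..t}"
    have sub: "{0..t} \<subseteq> {0..}" by auto
    have "(u has_vector_derivative A s *v u s) (at s within {0..})" using h s by simp
    from has_vector_derivative_within_subset[OF this sub]
    show "(u has_vector_derivative A s *v u s) (at s within {0..t})" .
  qed
  from absolutely_continuous_fundamental_theorem[OF t ac[OF t] this]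
  show "((\<lambda>s. A s *v u s) has_integral (u t - p)) {0..t}" by (simp add: u0)
qed

context bounded_matrix_path
begin

lemma picard_solution_has_vector_derivative_ae:
  "AE t in lborel. 0 \<le> t \<longrightarrow>
     (picard_solution B p has_vector_derivative B t *v picard_solution B p t) (at t within {0..})"
proof -
  let ?g = "\<lambda>s. B s *v picard_solution B p s"
  \<comment> \<open>The differentiation theorem lives on compact intervals. All integers n share one
    null set, and a strict t < n lets the derivative within {0..n} be read within {0..}.\<close>
  have "AE t in lborel. \<forall>n::nat. t \<in> {0..real n} \<longrightarrow>
      ((\<lambda>t. integral {0..t} ?g) has_vector_derivative ?g t) (at t within {0..real n})"
    unfolding AE_all_countable
    by (intro allI indefinite_integral_has_vector_derivative_ae has_integral_integrable[OF picard_solution_integral])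
       simp
  then show ?thesis
  proof (rule AE_mp, intro AE_I2 impI)
    fix t :: real
    assume *: "\<forall>n::nat. t \<in> {0..real n} \<longrightarrow>
      ((\<lambda>t. integral {0..t} ?g) has_vector_derivative ?g t) (at t within {0..real n})" and t: "0 \<le> t"
    obtain n where n: "t < real n" using reals_Archimedean2 by blast
    then have "((\<lambda>t. integral {0..t} ?g) has_vector_derivative ?g t) (at t within {0..real n})"
      using * t by simp
    then have "((\<lambda>t. integral {0..t} ?g) has_vector_derivative ?g t) (at t within {0..})"
      using at_within_Icc_eq_Ici[OF t n] by simp
    then have d: "((\<lambda>t. p + integral {0..t} ?g) has_vector_derivative 0 + ?g t) (at t within {0..})"
      by (intro has_vector_derivative_add has_vector_derivative_const)
    have "picard_solution B p s = p + integral {0..s} ?g" if "s \<in> {0..}" for s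
      using integral_unique[OF picard_solution_integral[of s p]] that by simp
    from has_vector_derivative_transform[OF _ this d]
    show "(picard_solution B p has_vector_derivative ?g t) (at t within {0..})" using t by simp
  qed
qed

text \<open>\<open>K\<close> shifts the diagonal: with \<open>K\<close> large, \<open>B\<close> is a nonnegative matrix although \<open>B - K\<close> is
  not.\<close>

lemma caratheodory_solution_shifted:
  assumes K: "0 \<le> K"
  shows "caratheodory_solution (\<lambda>s. B s - K *\<^sub>R mat 1) p (\<lambda>t. exp (- K * t) *\<^sub>R picard_solution B p t)"
  unfolding caratheodory_solution_def
proof (intro conjI allI impI)
  show "exp (- K * 0) *\<^sub>R picard_solution B p 0 = p"
    using integral_solution_0[OF picard_integral_solution] by simp
next
  fix T :: real assume T: "0 \<le> T"
  let ?w = "picard_solution B p"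
  let ?R = "norm p * exp (L * T)"
  show "absolutely_continuous_on {0..T} (\<lambda>t. exp (- K * t) *\<^sub>R ?w t)"
  proof (rule lipschitz_imp_absolutely_continuous_on)
    fix a b assume ab: "a \<in> {0..T}" "b \<in> {0..T}" "a \<le> b"
    \<comment> \<open>A product of bounded Lipschitz functions: exp (- K * t) has Lipschitz constant
      K on nonnegative times, because 1 - exp (- x) \<le> x.\<close>
    have "exp (- K * b) *\<^sub>R ?w b - exp (- K * a) *\<^sub>R ?w a
        = exp (- K * b) *\<^sub>R (?w b - ?w a) + (exp (- K * b) - exp (- K * a)) *\<^sub>R ?w a"
      by (simp add: algebra_simps)
    also have "norm \<dots> \<le> norm (exp (- K * b) *\<^sub>R (?w b - ?w a)) + norm ((exp (- K * b) - exp (- K * a)) *\<^sub>R ?w a)"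
      by (rule norm_triangle_ineq)
    also have "\<dots> = exp (- K * b) * norm (?w b - ?w a) + \<bar>exp (- K * b) - exp (- K * a)\<bar> * norm (?w a)"
      by simp
    also have "\<dots> \<le> 1 * (L * ?R * (b - a)) + (K * (b - a)) * ?R"
    proof (intro add_mono mult_mono)
      show "norm (?w b - ?w a) \<le> L * ?R * (b - a)"
        using picard_solution_lipschitz[of a b T p] ab by simp
      have "norm (?w a) \<le> norm p * exp (L * a)" using picard_solution_bound ab by simp
      also have "\<dots> \<le> ?R" using ab L_nonneg by (intro mult_left_mono) (auto intro: mult_left_mono)
      finally show "norm (?w a) \<le> ?R" .
      have "exp (- K * a) - exp (- K * b) = exp (- K * a) * (1 - exp (- (K * (b - a))))"
        by (simp add: algebra_simps flip: exp_add)
      also have "\<dots> \<le> 1 * (K * (b - a))"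
      proof (rule mult_mono)
        show "1 - exp (- (K * (b - a))) \<le> K * (b - a)"
          using exp_ge_add_one_self[of "- (K * (b - a))"] by simp
      qed (use K ab in auto)
      finally have "exp (- K * a) - exp (- K * b) \<le> K * (b - a)" by simp
      moreover have "exp (- K * b) \<le> exp (- K * a)" using K ab by (auto intro: mult_left_mono)
      ultimately show "\<bar>exp (- K * b) - exp (- K * a)\<bar> \<le> K * (b - a)" by simp
    qed (use K ab in auto)
    also have "\<dots> = (L * ?R + K * ?R) * (b - a)" by (simp add: algebra_simps)
    finally show "norm (exp (- K * b) *\<^sub>R ?w b - exp (- K * a) *\<^sub>R ?w a) \<le> (L * ?R + K * ?R) * (b - a)" .
  qed
next
  show "AE t in lborel. 0 \<le> t \<longrightarrow> ((\<lambda>t. exp (- K * t) *\<^sub>R picard_solution B p t) has_vector_derivative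
      (B t - K *\<^sub>R mat 1) *v (exp (- K * t) *\<^sub>R picard_solution B p t)) (at t within {0..})"
    using picard_solution_has_vector_derivative_ae[of p]
  proof (rule AE_mp, intro AE_I2 impI)
    fix t :: real
    assume "0 \<le> t \<longrightarrow> (picard_solution B p has_vector_derivative B t *v picard_solution B p t) (at t within {0..})"
      and "0 \<le> t"
    then have d: "(picard_solution B p has_vector_derivative B t *v picard_solution B p t) (at t within {0..})" by simp
    have "((\<lambda>t. exp (- K * t)) has_real_derivative (- K * exp (- K * t))) (at t within {0..})"
      by (auto intro!: derivative_eq_intros)
    from has_vector_derivative_scaleR[OF this d]
    have "((\<lambda>t. exp (- K * t) *\<^sub>R picard_solution B p t) has_vector_derivative
      exp (- K * t) *\<^sub>R (B t *v picard_solution B p t) + (- K * exp (- K * t)) *\<^sub>R picard_solution B p t)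
      (at t within {0..})" .
    moreover have "exp (- K * t) *\<^sub>R (B t *v picard_solution B p t) + (- K * exp (- K * t)) *\<^sub>R picard_solution B p t
      = (B t - K *\<^sub>R mat 1) *v (exp (- K * t) *\<^sub>R picard_solution B p t)"
      by (simp add: matrix_vector_mult_diff_rdistrib matrix_vector_mult_scaleR
          scaleR_matrix_vector_assoc[symmetric] algebra_simps)
    ultimately show "((\<lambda>t. exp (- K * t) *\<^sub>R picard_solution B p t) has_vector_derivative
      (B t - K *\<^sub>R mat 1) *v (exp (- K * t) *\<^sub>R picard_solution B p t)) (at t within {0..})"
      by (simp only:)
  qed
qed

lemma shifted_bounded_matrix_path:
  assumes K: "0 \<le> K"
  shows "bounded_matrix_path (\<lambda>s. B s - K *\<^sub>R mat 1) (L + K)"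
proof
  fix i j show "(\<lambda>s. (B s - K *\<^sub>R mat 1) $ i $ j) \<in> borel_measurable borel"
    using meas[of i j] by simp
next
  fix s x
  have "norm ((B s - K *\<^sub>R mat 1) *v x) = norm (B s *v x - K *\<^sub>R x)"
    by (simp add: matrix_vector_mult_diff_rdistrib scaleR_matrix_vector_assoc[symmetric])
  also have "\<dots> \<le> norm (B s *v x) + norm (K *\<^sub>R x)" by (rule norm_triangle_ineq4)
  also have "\<dots> \<le> (L + K) * norm x" using bound[of s x] K by (simp add: algebra_simps)
  finally show "norm ((B s - K *\<^sub>R mat 1) *v x) \<le> (L + K) * norm x" .
qed (use L_nonneg K in simp)

text \<open>Here the definite description in \<open>solution_at\<close> gets its value: existence is
  the explicit solution, uniqueness comes from the integral form.\<close>

lemma solution_at_shifted: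
  assumes K: "0 \<le> K" and t: "0 \<le> t"
  shows "solution_at (\<lambda>s. B s - K *\<^sub>R mat 1) p t = exp (- K * t) *\<^sub>R picard_solution B p t"
  unfolding solution_at_def
proof (rule the_equality)
  show "\<exists>u. caratheodory_solution (\<lambda>s. B s - K *\<^sub>R mat 1) p u \<and> u t = exp (- K * t) *\<^sub>R picard_solution B p t"
    using caratheodory_solution_shifted[OF K] by blast
next
  interpret S: bounded_matrix_path "\<lambda>s. B s - K *\<^sub>R mat 1" "L + K"
    by (rule shifted_bounded_matrix_path[OF K])
  fix x assume "\<exists>u. caratheodory_solution (\<lambda>s. B s - K *\<^sub>R mat 1) p u \<and> u t = x"
  then obtain u where u: "caratheodory_solution (\<lambda>s. B s - K *\<^sub>R mat 1) p u" "u t = x" by blast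
  from S.integral_solution_unique[OF caratheodory_imp_integral_solution[OF u(1)]
      caratheodory_imp_integral_solution[OF caratheodory_solution_shifted[OF K]] t]
  show "x = exp (- K * t) *\<^sub>R picard_solution B p t" using u(2) by simp
qed

end

lemma (in bounded_matrix_path) integral_solution_solution_at:
  "integral_solution B p (solution_at B p)"
proof -
  \<comment> \<open>Shift 0 identifies both functions at nonnegative times, the only ones that
    \<open>integral_solution\<close> sees.\<close>
  have eq: "solution_at B p t = picard_solution B p t" if "0 \<le> t" for t
    using solution_at_shifted[of 0, OF _ that] by simp
  have "continuous_on {0..} (solution_at B p) \<longleftrightarrow> continuous_on {0..} (picard_solution B p)"
    by (rule continuous_on_cong) (auto simp: eq)
  moreover have "((\<lambda>s. B s *v solution_at B p s) has_integral (solution_at B p t - p)) {0..t} \<longleftrightarrow>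
      ((\<lambda>s. B s *v picard_solution B p s) has_integral (picard_solution B p t - p)) {0..t}"
    if "0 \<le> t" for t
    unfolding eq[OF that] by (rule has_integral_cong) (simp add: eq)
  ultimately show ?thesis
    using picard_integral_solution[of p] unfolding integral_solution_def by blast
qed

lemma (in bounded_matrix_path) solution_at_eqI:
  assumes "integral_solution B p u" "0 \<le> t"
  shows "solution_at B p t = u t"
  by (rule integral_solution_unique[OF integral_solution_solution_at assms])

section \<open>The tridiagonal generator\<close>

lemma pos_ge_1: "1 \<le> pos (i :: 'n::{finite,linorder})"
  and pos_le_card: "pos (i :: 'n::{finite,linorder}) \<le> CARD('n)"
  using bij_betw_pos[where 'n = 'n] by (auto simp: bij_betw_def)

lemma pos_eq_iff: "pos i = pos j \<longleftrightarrow> i = (j :: 'n::{finite,linorder})"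
  using bij_betw_pos[where 'n = 'n] by (auto simp: bij_betw_def inj_on_def)

lemma ex_pos:
  assumes "1 \<le> k" "k \<le> CARD('n)"
  shows "\<exists>i :: 'n::{finite,linorder}. pos i = k"
proof -
  have "k \<in> range (pos :: 'n \<Rightarrow> nat)"
    using bij_betw_pos[where 'n = 'n] assms by (simp add: bij_betw_def)
  then show ?thesis by blast
qed

lemma rate_matrix_column_sum:
  fixes j :: "'n::{finite,linorder}"
  assumes N: "2 \<le> CARD('n)"
  shows "(\<Sum>i\<in>UNIV. (rate_matrix q :: real ^ 'n::{finite,linorder} ^ 'n::{finite,linorder}) $ i $ j) = 0"
proof -
  let ?N = "CARD('n)"
  define m where "m = pos j"
  have m: "1 \<le> m" "m \<le> ?N" unfolding m_def by (rule pos_ge_1, rule pos_le_card)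
  define d where "d = (if m = 1 then - q 1 else if m = ?N then - q (2 * ?N - 2)
        else - (q (2 * m - 2) + q (2 * m - 1)))"
  \<comment> \<open>Column \<open>j\<close> as a function of the row number. For m = 1 the truncated
    m - 1 is 0, which is no row number, so the superdiagonal term disappears from the sum as it
    should.\<close>
  define h where "h = (\<lambda>a. (if a = m + 1 then q (2 * m - 1) else 0)
     + (if a = m - 1 then q (2 * (m - 1)) else 0) + (if a = m then d else 0))"
  have "(rate_matrix q :: real ^ 'n::{finite,linorder} ^ 'n::{finite,linorder}) $ i $ j = h (pos i)" for i
  proof -
    have a: "1 \<le> pos i" by (rule pos_ge_1)
    have eq: "i = j \<longleftrightarrow> pos i = m" by (simp add: m_def pos_eq_iff)
    consider "pos i = m + 1" | "m = pos i + 1" | "pos i = m" | "pos i \<noteq> m + 1" "m \<noteq> pos i + 1" "pos i \<noteq> m"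
      by blast
    then show ?thesis
    proof cases
      case 1 then show ?thesis by (simp add: rate_matrix_def h_def flip: m_def)
    next
      case 2 then show ?thesis using a by (simp add: rate_matrix_def h_def flip: m_def)
    next
      case 3
      then have "pos i \<noteq> m - 1" using a by linarith
      with 3 show ?thesis using eq by (simp add: rate_matrix_def h_def d_def flip: m_def)
    next
      case 4
      then have "pos i \<noteq> m - 1" using a by linarith
      with 4 show ?thesis using eq by (simp add: rate_matrix_def h_def flip: m_def)
    qed
  qed
  then have "(\<Sum>i\<in>UNIV. (rate_matrix q :: real ^ 'n::{finite,linorder} ^ 'n::{finite,linorder}) $ i $ j) = (\<Sum>i::'n\<in>UNIV. h (pos i))"
    by simp
  also have "\<dots> = (\<Sum>a\<in>{1..?N}. h a)"
    by (rule sum.reindex_bij_betw[OF bij_betw_pos])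
  also have "\<dots> = (if m + 1 \<le> ?N then q (2 * m - 1) else 0) + (if 2 \<le> m then q (2 * (m - 1)) else 0) + d"
    unfolding h_def sum.distrib using m by (subst (1 2 3) sum.delta) auto
  also have "\<dots> = 0"
  proof -
    have "2 * (m - 1) = 2 * m - 2" by arith
    then show ?thesis
      unfolding d_def using m N by (cases "m = 1"; cases "m = ?N") simp_all
  qed
  finally show ?thesis .
qed

lemma rate_index:
  fixes i j :: "'n::{finite,linorder}"
  shows "pos i = pos j + 1 \<Longrightarrow> 2 * pos j - 1 \<in> {1..2 * CARD('n) - 2}"
    and "pos j = pos i + 1 \<Longrightarrow> 2 * pos i \<in> {1..2 * CARD('n) - 2}"
  using pos_ge_1[of i] pos_le_card[of i] pos_ge_1[of j] pos_le_card[of j] by auto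

context
  fixes q :: "nat \<Rightarrow> real" and c C :: real and Q :: "real ^ ('n::{finite,linorder}) ^ ('n::{finite,linorder})"
  assumes N: "2 \<le> CARD('n)" and c: "0 < c"
    and q: "\<And>k. k \<in> {1..2 * CARD('n) - 2} \<Longrightarrow> c \<le> q k \<and> q k \<le> C"
  defines "Q \<equiv> rate_matrix q"
begin

lemma rate_matrix_neighbour:
  assumes "pos i = pos j + 1 \<or> pos j = pos i + 1"
  shows "c \<le> Q $ i $ j" "Q $ i $ j \<le> C"
  using assms q[OF rate_index(1)[of i j]] q[OF rate_index(2)[of j i]] by (auto simp: Q_def rate_matrix_def)

text \<open>A state has at most two exits, each with rate at most \<open>C\<close>; this is the
  origin of the shift 2 * C.\<close>

lemma rate_matrix_diagonal: "- (2 * C) \<le> Q $ i $ i" "Q $ i $ i \<le> 0"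
proof -
  have 1: "c \<le> q 1 \<and> q 1 \<le> C" using N by (intro q) auto
  have 2: "c \<le> q (2 * CARD('n) - 2) \<and> q (2 * CARD('n) - 2) \<le> C" using N by (intro q) auto
  have 3: "c \<le> q (2 * pos i - 2) \<and> q (2 * pos i - 2) \<le> C" "c \<le> q (2 * pos i - 1) \<and> q (2 * pos i - 1) \<le> C"
    if "pos i \<noteq> 1" "pos i \<noteq> CARD('n)"
    using that pos_ge_1[of i] pos_le_card[of i] by (intro q; simp; linarith)+
  show "- (2 * C) \<le> Q $ i $ i" "Q $ i $ i \<le> 0"
    using 1 2 3 c by (auto simp: Q_def rate_matrix_def)
qed

lemma rate_matrix_zero:
  assumes "i \<noteq> j" "pos i \<noteq> pos j + 1" "pos j \<noteq> pos i + 1"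
  shows "Q $ i $ j = 0"
  using assms by (auto simp: Q_def rate_matrix_def)

text \<open>The lower bound gives positivity of the Picard terms, the upper one a bound on the
  operator norm.\<close>

lemma rate_matrix_shifted:
  "0 \<le> (Q + (2 * C) *\<^sub>R mat 1) $ i $ j" "(Q + (2 * C) *\<^sub>R mat 1) $ i $ j \<le> 2 * C"
proof -
  have "c \<le> q 1 \<and> q 1 \<le> C" using N by (intro q) auto
  then have C: "0 \<le> C" using c by simp
  have "0 \<le> (Q + (2 * C) *\<^sub>R mat 1) $ i $ j \<and> (Q + (2 * C) *\<^sub>R mat 1) $ i $ j \<le> 2 * C"
  proof (cases "i = j")
    case True
    then show ?thesis using rate_matrix_diagonal[of i] by (simp add: mat_def)
  next
    case False
    then show ?thesis using rate_matrix_neighbour[of i j] rate_matrix_zero[of i j] c C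
      by (cases "pos i = pos j + 1 \<or> pos j = pos i + 1") (auto simp: mat_def)
  qed
  then show "0 \<le> (Q + (2 * C) *\<^sub>R mat 1) $ i $ j" "(Q + (2 * C) *\<^sub>R mat 1) $ i $ j \<le> 2 * C" by auto
qed

end

text \<open>
  \<open>K\<close> bounds the exit rates, so that \<open>A + K\<close> is nonnegative.
\<close>

locale generator_path =
  fixes A :: "real \<Rightarrow> real ^ ('n::{finite,linorder}) ^ ('n::{finite,linorder})" and c K :: real
  assumes meas: "\<And>i j. (\<lambda>s. A s $ i $ j) \<in> borel_measurable borel"
    and shifted_nonneg: "\<And>s i j. 0 \<le> (A s + K *\<^sub>R mat 1) $ i $ j"
    and shifted_le: "\<And>s i j. (A s + K *\<^sub>R mat 1) $ i $ j \<le> K"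
    and column_sum: "\<And>s j. (\<Sum>i\<in>UNIV. A s $ i $ j) = 0"
    and neighbour: "\<And>s i j. pos i = pos j + 1 \<or> pos j = pos i + 1 \<Longrightarrow> c \<le> A s $ i $ j"
    and c_pos: "0 < c"
begin

abbreviation "B \<equiv> \<lambda>s. A s + K *\<^sub>R mat 1"

lemma K_nonneg: "0 \<le> K"
  using order_trans[OF shifted_nonneg shifted_le] .

text \<open>The constant is the number of entries times the largest possible entry. The shifted path
  provides positivity; \<open>A\<close> itself, interpreted next, provides uniqueness for the actual
  equation.\<close>

sublocale shifted: bounded_matrix_path B "real CARD('n) * real CARD('n) * K"
proof
  show "(\<lambda>s. B s $ i $ j) \<in> borel_measurable borel" for i j
    using meas[of i j] by simp
  show "norm (B s *v x) \<le> real CARD('n) * real CARD('n) * K * norm x" for s x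
  proof -
    have "onorm ((*v) (B s)) \<le> real CARD('n) * real CARD('n) * K"
      using shifted_nonneg[of s] shifted_le[of s] by (intro onorm_le_matrix_component) (simp add: abs_le_iff order_trans[OF _ shifted_nonneg])
    then show ?thesis
      using onorm[OF matrix_vector_mul_bounded_linear[of "B s"], of x]
      by (meson mult_right_mono norm_ge_zero order_trans)
  qed
qed (simp add: K_nonneg)

sublocale bounded_matrix_path A "real CARD('n) * real CARD('n) * K + K"
  using shifted.shifted_bounded_matrix_path[OF K_nonneg] by simp

section \<open>Linearity, conservation of mass and quantitative positivity of the flow\<close>

lemma solution_at_eq_picard:
  "0 \<le> t \<Longrightarrow> solution_at A p t = exp (- K * t) *\<^sub>R picard_solution B p t"
  using shifted.solution_at_shifted[OF K_nonneg, of t p] by simp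

text \<open>A combination of solutions solves the equation, and uniqueness identifies it.\<close>

lemma solution_at_linear:
  assumes t: "0 \<le> t"
  shows "linear (\<lambda>p. solution_at A p t)"
proof -
  have *: "solution_at A (a *\<^sub>R p + b *\<^sub>R r) t = a *\<^sub>R solution_at A p t + b *\<^sub>R solution_at A r t" for a b p r
    by (rule solution_at_eqI[OF integral_solution_linear t]) (rule integral_solution_solution_at)+
  show ?thesis
    by (rule linearI) (use *[of 1 _ 1] *[of _ _ 0] in simp_all)
qed

lemma solution_at_0: "solution_at A p 0 = p"
  by (rule integral_solution_0[OF integral_solution_solution_at])

text \<open>The coordinates of the right-hand side add up to 0 because the columns of
  \<open>A\<close> do.\<close>

lemma solution_at_sum:
  assumes t: "0 \<le> t"
  shows "(\<Sum>i\<in>UNIV. solution_at A p t $ i) = (\<Sum>i\<in>UNIV. p $ i)"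
proof -
  let ?u = "solution_at A p"
  have bl: "bounded_linear (\<lambda>x. \<Sum>i\<in>(UNIV :: 'n set). x $ i :: real)"
    by (intro bounded_linear_sum bounded_linear_vec_nth)
  have "((\<lambda>s. A s *v ?u s) has_integral (?u t - p)) {0..t}"
    using integral_solution_solution_at[of p] t by (simp add: integral_solution_def)
  from has_integral_linear[OF this bl]
  have "((\<lambda>s. \<Sum>i\<in>UNIV. (A s *v ?u s) $ i) has_integral (\<Sum>i\<in>UNIV. (?u t - p) $ i)) {0..t}"
    by (simp only: o_def)
  moreover have "(\<Sum>i\<in>UNIV. (A s *v x) $ i) = 0" for s x
  proof -
    have "(\<Sum>i\<in>UNIV. (A s *v x) $ i) = (\<Sum>j\<in>UNIV. \<Sum>i\<in>UNIV. A s $ i $ j * x $ j)"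
      unfolding matrix_vector_mult_def by (simp add: sum.swap[of "\<lambda>i j. A s $ i $ j * x $ j"])
    also have "\<dots> = 0" by (simp add: sum_distrib_right[symmetric] column_sum)
    finally show ?thesis .
  qed
  ultimately have "((\<lambda>s. 0::real) has_integral (\<Sum>i\<in>UNIV. (?u t - p) $ i)) {0..t}" by simp
  from has_integral_unique[OF this has_integral_0] show ?thesis by (simp add: sum_subtractf)
qed

lemma solution_at_nonneg:
  assumes "\<And>i. 0 \<le> p $ i" and "0 \<le> t"
  shows "0 \<le> solution_at A p t $ i"
  using shifted.picard_solution_nonneg[OF shifted_nonneg assms(1) assms(2)]
  by (simp add: solution_at_eq_picard[OF assms(2)])

text \<open>Integrates a lower bound on the speed of one coordinate: m = 0 yields monotonicity, a
  positive m the inflow from a neighbour.\<close>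

lemma picard_increment:
  assumes p: "\<And>i. 0 \<le> p $ i" and ab: "0 \<le> a" "a \<le> b"
    and m: "\<And>s. a \<le> s \<Longrightarrow> s \<le> b \<Longrightarrow> m \<le> (B s *v picard_solution B p s) $ i"
  shows "m * (b - a) \<le> picard_solution B p b $ i - picard_solution B p a $ i"
proof -
  have "((\<lambda>s. (B s *v picard_solution B p s) $ i) has_integral (picard_solution B p b $ i - picard_solution B p a $ i)) {a..b}"
    using has_integral_linear[OF integral_solution_Icc[OF shifted.picard_integral_solution[of p] ab] bounded_linear_vec_nth[of i]]
    by (simp add: o_def)
  from has_integral_le[OF has_integral_const_real[of m a b] this] m show ?thesis
    using ab by (simp add: mult.commute)
qed

text \<open>This is the gain from the shift: all velocities are nonnegative, so positivity once
  reached is not lost again.\<close>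

lemma picard_mono:
  assumes p: "\<And>i. 0 \<le> p $ i" and ab: "0 \<le> a" "a \<le> b"
  shows "picard_solution B p a $ i \<le> picard_solution B p b $ i"
proof -
  have "0 * (b - a) \<le> picard_solution B p b $ i - picard_solution B p a $ i"
  proof (rule picard_increment[OF p ab])
    fix s assume "a \<le> s"
    then show "0 \<le> (B s *v picard_solution B p s) $ i"
      using ab by (auto simp: matrix_vector_mult_def simp del: vector_add_component
          intro!: sum_nonneg mult_nonneg_nonneg shifted_nonneg shifted.picard_solution_nonneg p)
  qed
  then show ?thesis by simp
qed

text \<open>On [a, b] coordinate \<open>j\<close> keeps at least its value at \<open>a\<close> and
  feeds coordinate \<open>i\<close> at rate at least \<open>c\<close>.\<close>

lemma picard_neighbour:
  assumes p: "\<And>i. 0 \<le> p $ i" and ab: "0 \<le> a" "a \<le> b"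
    and ij: "pos i = pos j + 1 \<or> pos j = pos i + 1"
  shows "c * picard_solution B p a $ j * (b - a) \<le> picard_solution B p b $ i"
proof -
  let ?w = "picard_solution B p"
  have nn: "0 \<le> ?w s $ k" if "0 \<le> s" for s k
    by (rule shifted.picard_solution_nonneg[OF shifted_nonneg p that])
  have "c * ?w a $ j * (b - a) \<le> ?w b $ i - ?w a $ i"
  proof (rule picard_increment[OF p ab])
    fix s assume s: "a \<le> s" "s \<le> b"
    have "i \<noteq> j" using ij by auto
    then have "c \<le> B s $ i $ j" using neighbour[OF ij, of s] by (simp add: mat_def)
    then have "c * ?w a $ j \<le> B s $ i $ j * ?w s $ j"
      using s ab c_pos nn[of a j] picard_mono[OF p ab(1) s(1)] shifted_nonneg by (intro mult_mono) auto
    also have "\<dots> \<le> (\<Sum>k\<in>UNIV. B s $ i $ k * ?w s $ k)"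
      using s ab by (intro member_le_sum mult_nonneg_nonneg shifted_nonneg nn) auto
    also have "\<dots> = (B s *v ?w s) $ i" by (simp add: matrix_vector_mult_def)
    finally show "c * ?w a $ j \<le> (B s *v ?w s) $ i" .
  qed
  with nn[OF ab(1), of i] show ?thesis by linarith
qed

text \<open>Positivity spreads to one further neighbour in each time step of length \<open>1 / N\<close>.\<close>

lemma picard_lower_bound:
  assumes p: "\<And>i. 0 \<le> p $ i" and j: "1 / CARD('n) \<le> p $ j"
    and i: "pos i \<le> pos j + d" "pos j \<le> pos i + d"
  shows "(min 1 (c / CARD('n))) ^ d / CARD('n) \<le> picard_solution B p (d / CARD('n)) $ i"
  using i
proof (induction d arbitrary: i)
  case 0
  then have "i = j" by (simp add: pos_eq_iff[symmetric])
  with j integral_solution_0[OF shifted.picard_integral_solution[of p]] show ?case by simp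
next
  case (Suc d)
  let ?N = "real CARD('n)" and ?w = "picard_solution B p" and ?\<delta> = "min 1 (c / CARD('n))"
  have N: "0 < ?N" by simp
  have \<delta>: "0 < ?\<delta>" using c_pos by simp
  have t: "0 \<le> real d / ?N" "real d / ?N \<le> real (Suc d) / ?N" by (simp_all add: divide_right_mono)
  show ?case
  proof (cases "pos i \<le> pos j + d \<and> pos j \<le> pos i + d")
    case True
    \<comment> \<open>Index \<open>i\<close> was already reached. The cap 1 in
      \<open>?\<delta>\<close> makes the claimed bound weaker as d grows.\<close>
    have "?\<delta> ^ Suc d / ?N \<le> ?\<delta> ^ d / ?N"
      using \<delta> by (intro divide_right_mono power_decreasing) auto
    also have "\<dots> \<le> ?w (real d / ?N) $ i" using Suc.IH True by simp
    also have "\<dots> \<le> ?w (real (Suc d) / ?N) $ i" by (rule picard_mono[OF p t])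
    finally show ?thesis .
  next
    case False
    \<comment> \<open>Now \<open>i\<close> is at distance exactly d + 1 from \<open>j\<close>; the
      witness is its neighbour one step towards \<open>j\<close>.\<close>
    have "\<exists>k::'n. (pos i = pos k + 1 \<or> pos k = pos i + 1) \<and> pos k \<le> pos j + d \<and> pos j \<le> pos k + d"
    proof (cases "pos i \<le> pos j + d")
      case True
      have "1 \<le> pos i + 1" "pos i + 1 \<le> CARD('n)"
        using True False pos_le_card[of j] by linarith+
      from ex_pos[OF this] obtain k :: 'n where "pos k = pos i + 1" by blast
      then show ?thesis using True False Suc.prems by (intro exI[of _ k]) auto
    next
      case F: False
      have "1 \<le> pos i - 1" "pos i - 1 \<le> CARD('n)"
        using F pos_le_card[of i] pos_ge_1[of j] by linarith+
      from ex_pos[OF this] obtain k :: 'n where "pos k = pos i - 1" by blast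
      then show ?thesis using F Suc.prems pos_ge_1[of i] by (intro exI[of _ k]) auto
    qed
    then obtain k :: 'n where k: "pos i = pos k + 1 \<or> pos k = pos i + 1"
      and kj: "pos k \<le> pos j + d" "pos j \<le> pos k + d" by blast
    have "?\<delta> ^ Suc d / ?N = ?\<delta> * (?\<delta> ^ d / ?N)" by simp
    also have "\<dots> \<le> (c / ?N) * ?w (real d / ?N) $ k"
      using Suc.IH[OF kj] \<delta> c_pos by (intro mult_mono) auto
    also have "\<dots> = c * ?w (real d / ?N) $ k * (real (Suc d) / ?N - real d / ?N)"
      by (simp add: field_simps)
    also have "\<dots> \<le> ?w (real (Suc d) / ?N) $ i"
      by (rule picard_neighbour[OF p t k])
    finally show ?thesis .
  qed
qed

lemma solution_at_simplex:
  assumes p: "p \<in> prob_simplex" and t: "0 \<le> t"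
  shows "solution_at A p t \<in> prob_simplex"
proof -
  let ?x = "solution_at A p t"
  have nn: "0 \<le> ?x $ i" for i
    using p by (intro solution_at_nonneg t) (auto simp: prob_simplex_def)
  have s: "(\<Sum>i\<in>UNIV. ?x $ i) = 1"
    using solution_at_sum[OF t, of p] p by (simp add: prob_simplex_def)
  have "?x $ i \<le> (\<Sum>i\<in>UNIV. ?x $ i)" for i
    using nn by (intro member_le_sum) auto
  with nn s show ?thesis by (simp add: prob_simplex_def)
qed

text \<open>Some coordinate is at least 1 / N, which is the last factor; N steps of length 1 / N
  reach every index from it, which gives the N-th power; exp (- K) undoes the shift at time
  1.\<close>

lemma solution_at_lower_bound:
  assumes p: "p \<in> prob_simplex"
  shows "exp (- K) * ((min 1 (c / CARD('n))) ^ CARD('n) / CARD('n)) \<le> solution_at A p 1 $ i"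
proof -
  have p0: "0 \<le> p $ i" for i using p by (auto simp: prob_simplex_def)
  have "\<exists>j. 1 / CARD('n) \<le> p $ j"
  proof (rule ccontr)
    assume "\<not> ?thesis"
    then have "(\<Sum>j\<in>UNIV. p $ j) < (\<Sum>j::'n\<in>UNIV. 1 / CARD('n))"
      by (intro sum_strict_mono) (auto simp: not_le)
    with p show False by (simp add: prob_simplex_def)
  qed
  then obtain j where j: "1 / CARD('n) \<le> p $ j" by blast
  have "(min 1 (c / CARD('n))) ^ CARD('n) / CARD('n) \<le> picard_solution B p (CARD('n) / CARD('n)) $ i"
    using pos_le_card[of i] pos_le_card[of j] by (intro picard_lower_bound[OF p0 j]) auto
  from mult_left_mono[OF this, of "exp (- K)"] show ?thesis
    by (simp add: solution_at_eq_picard)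
qed

end

section \<open>The Hilbert metric and positive linear cocycles\<close>

lemma prob_simplexD:
  assumes "x \<in> prob_simplex"
  shows "0 \<le> x $ i" "x $ i \<le> 1" "(\<Sum>i\<in>UNIV. x $ i) = 1"
  using assms by (auto simp: prob_simplex_def)

lemma prob_simplexI:
  assumes nn: "\<And>i. 0 \<le> x $ i" and s: "(\<Sum>i\<in>UNIV. x $ i) = 1"
  shows "x \<in> prob_simplex"
proof -
  have "x $ i \<le> (\<Sum>i\<in>UNIV. x $ i)" for i
    using nn by (intro member_le_sum) auto
  with nn s show ?thesis by (simp add: prob_simplex_def)
qed

lemma closed_prob_simplex: "closed (prob_simplex :: (real ^ 'n::finite) set)"
proof -
  have "prob_simplex = (\<Inter>j. {p :: real ^ 'n. 0 \<le> p $ j}) \<inter> (\<Inter>j. {p. p $ j \<le> 1}) \<inter> {p. (\<Sum>j\<in>UNIV. p $ j) = 1}"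
    by (auto simp: prob_simplex_def)
  moreover have "closed \<dots>"
    by (intro closed_Int closed_INT ballI closed_Collect_le closed_Collect_eq continuous_intros)
  ultimately show ?thesis by simp
qed

text \<open>Compare the total masses, both 1. This keeps all logarithms of factors
  nonnegative.\<close>

lemma dominating_factor_ge_1:
  assumes x: "x \<in> prob_simplex" and y: "y \<in> prob_simplex" and m: "\<And>i. y $ i \<le> m * x $ i"
  shows "1 \<le> m"
proof -
  have "(\<Sum>i\<in>UNIV. y $ i) \<le> (\<Sum>i\<in>UNIV. m * x $ i)" by (rule sum_mono) (rule m)
  then show ?thesis using prob_simplexD(3)[OF x] prob_simplexD(3)[OF y]
    by (simp add: sum_distrib_left[symmetric])
qed

lemma max_ratio_ge_1:
  assumes "x \<in> prob_simplex" "y \<in> prob_simplex"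
  shows "1 \<le> max_ratio y x"
  unfolding max_ratio_def
  by (rule Inf_greatest) (use dominating_factor_ge_1[OF assms] in \<open>auto simp: one_ereal_def\<close>)

lemma max_ratio_le:
  assumes "0 \<le> m" "\<And>i. y $ i \<le> m * x $ i"
  shows "max_ratio y x \<le> ereal m"
  unfolding max_ratio_def by (rule Inf_lower) (use assms in auto)

text \<open>Admissible factors come arbitrarily close to the infimum, and since x_i \<le> 1 an
  excess e in the factor costs at most e in the inequality.\<close>

lemma max_ratio_attained:
  assumes x: "x \<in> prob_simplex" and r: "max_ratio y x = ereal r"
  shows "y $ i \<le> r * x $ i"
proof (rule field_le_epsilon)
  fix e :: real assume e: "0 < e"
  have "max_ratio y x < ereal (r + e)" using r e by simp
  then obtain k where k: "y $ i \<le> k * x $ i" "k < r + e"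
    unfolding max_ratio_def Inf_less_iff by auto
  have "k * x $ i \<le> (r + e) * x $ i" using k prob_simplexD[OF x] by (intro mult_right_mono) auto
  also have "\<dots> \<le> r * x $ i + e * 1" using e prob_simplexD(2)[OF x, of i] by (simp add: algebra_simps)
  finally show "y $ i \<le> r * x $ i + e" using k by simp
qed

text \<open>Together with \<open>hilbert_metric_finiteE\<close> this translates between the metric
  and pairs of dominating factors, so that later estimates need no infima.\<close>

lemma hilbert_metric_le:
  assumes x: "x \<in> prob_simplex" and y: "y \<in> prob_simplex"
    and m: "\<And>i. y $ i \<le> m * x $ i" and m': "\<And>i. x $ i \<le> m' * y $ i"
  shows "hilbert_metric x y \<le> ereal (ln m + ln m')"
proof -
  have m1: "1 \<le> m" "1 \<le> m'"
    using dominating_factor_ge_1[OF x y m] dominating_factor_ge_1[OF y x m'] by auto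
  have a: "max_ratio y x \<le> ereal m" "max_ratio x y \<le> ereal m'"
    using m m' m1 by (auto intro!: max_ratio_le)
  have b: "1 \<le> max_ratio y x" "1 \<le> max_ratio x y"
    using max_ratio_ge_1 x y by auto
  obtain r where r: "max_ratio y x = ereal r" "1 \<le> r" "r \<le> m"
    using a(1) b(1) by (cases "max_ratio y x") (auto simp: one_ereal_def)
  obtain r' where r': "max_ratio x y = ereal r'" "1 \<le> r'" "r' \<le> m'"
    using a(2) b(2) by (cases "max_ratio x y") (auto simp: one_ereal_def)
  have "ln (r * r') = ln r + ln r'" using r r' by (simp add: ln_mult)
  moreover have "ln r \<le> ln m" "ln r' \<le> ln m'" using r r' by auto
  ultimately show ?thesis by (simp add: hilbert_metric_def r r')
qed

lemma hilbert_metric_finiteE: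
  assumes x: "x \<in> prob_simplex" and y: "y \<in> prob_simplex" and fin: "hilbert_metric x y < \<infinity>"
  obtains m m' where "1 \<le> m" "1 \<le> m'" "\<And>i. y $ i \<le> m * x $ i" "\<And>i. x $ i \<le> m' * y $ i"
    "hilbert_metric x y = ereal (ln m + ln m')"
proof -
  have b: "1 \<le> max_ratio y x" "1 \<le> max_ratio x y"
    using max_ratio_ge_1 x y by auto
  \<comment> \<open>Both ratios are at least 1, so no product of 0 and \<infinity> can hide an
    infinite ratio: a finite product has finite factors.\<close>
  have ni: "max_ratio y x * max_ratio x y \<noteq> \<infinity>"
    using fin by (auto simp: hilbert_metric_def)
  then obtain r r' where r: "max_ratio y x = ereal r" "max_ratio x y = ereal r'"
    using b by (cases "max_ratio y x"; cases "max_ratio x y") (auto simp: one_ereal_def split: if_splits)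
  with b have r1: "1 \<le> r" "1 \<le> r'" by (auto simp: one_ereal_def)
  have "hilbert_metric x y = ereal (ln r + ln r')"
    using r1 by (simp add: hilbert_metric_def r ln_mult)
  then show thesis
    using that[OF r1 max_ratio_attained[OF x r(1)] max_ratio_attained[OF y r(2)]] by blast
qed

lemma hilbert_metric_nonneg:
  assumes x: "x \<in> prob_simplex" and y: "y \<in> prob_simplex"
  shows "0 \<le> hilbert_metric x y"
proof (cases "hilbert_metric x y < \<infinity>")
  case True
  then obtain m m' where "1 \<le> m" "1 \<le> m'" "hilbert_metric x y = ereal (ln m + ln m')"
    using hilbert_metric_finiteE[OF x y] by metis
  then show ?thesis by simp
qed simp

text \<open>Since ln m' \<ge> 0, a distance below ln (1 + e) forces m < 1 + e already; as x_i \<le>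
  1, the lower bound is then violated by at most e.\<close>

lemma metric_closed_in_lower_bound:
  "metric_closed_in prob_simplex hilbert_metric {x \<in> prob_simplex. \<forall>i. \<epsilon> \<le> x $ i}"
  unfolding metric_closed_in_def
proof (intro conjI ballI impI)
  fix x :: "real ^ 'n" assume x: "x \<in> prob_simplex"
    and lim: "\<forall>e>0. \<exists>y\<in>{x \<in> prob_simplex. \<forall>i. \<epsilon> \<le> x $ i}. hilbert_metric x y < e"
  have "\<epsilon> \<le> x $ i" for i
  proof (rule field_le_epsilon)
    fix e :: real assume e: "0 < e"
    have "0 < ereal (ln (1 + e))" using e by simp
    then obtain y where y: "y \<in> prob_simplex" "\<epsilon> \<le> y $ i" and h: "hilbert_metric x y < ereal (ln (1 + e))"
      using lim by blast
    from h have "hilbert_metric x y < \<infinity>" by auto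
    then obtain m m' where m: "1 \<le> m" "1 \<le> m'" "\<And>i. y $ i \<le> m * x $ i"
      and hm: "hilbert_metric x y = ereal (ln m + ln m')"
      using hilbert_metric_finiteE[OF x y(1)] by metis
    have "ln m + ln m' < ln (1 + e)" using h by (simp add: hm)
    then have "ln m < ln (1 + e)" using ln_ge_zero[OF m(2)] by linarith
    then have "m < 1 + e" using m e by simp
    then have "m * x $ i \<le> (1 + e) * x $ i" using prob_simplexD[OF x] by (intro mult_right_mono) auto
    also have "\<dots> \<le> x $ i + e * 1" using e prob_simplexD(2)[OF x, of i] by (simp add: algebra_simps)
    finally show "\<epsilon> \<le> x $ i + e" using y m(3)[of i] by simp
  qed
  with x show "x \<in> {x \<in> prob_simplex. \<forall>i. \<epsilon> \<le> x $ i}" by simp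
qed auto

text \<open>The inequality \<open>m powr (- (1 - \<epsilon>)) \<le> (1 - \<epsilon>) / m + \<epsilon>\<close> between weighted means replaces the
  projective diameter in Birkhoff's contraction theorem.\<close>

lemma dominating_factor_contraction:
  fixes f :: "real ^ 'n::finite \<Rightarrow> real ^ 'm::finite"
  assumes lin: "linear f"
    and nonneg: "\<And>v i. (\<And>j. 0 \<le> v $ j) \<Longrightarrow> 0 \<le> f v $ i"
    and lower: "\<And>v i. v \<in> prob_simplex \<Longrightarrow> \<epsilon> \<le> f v $ i"
    and upper: "\<And>v i. v \<in> prob_simplex \<Longrightarrow> f v $ i \<le> 1"
    and \<epsilon>: "0 < \<epsilon>" "\<epsilon> \<le> 1"
    and x: "x \<in> prob_simplex" and y: "y \<in> prob_simplex" and m: "\<And>i. y $ i \<le> m * x $ i"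
  shows "f y $ i \<le> m powr (1 - \<epsilon>) * f x $ i"
proof -
  have m1: "1 \<le> m" by (rule dominating_factor_ge_1[OF x y m])
  \<comment> \<open>The part of \<open>x\<close> not accounted for by y / m: nonnegative, of mass 1
    - 1 / m. After normalisation it is a probability vector, to which the lower bound \<epsilon>
    applies.\<close>
  define u where "u = x - (1 / m) *\<^sub>R y"
  have u0: "0 \<le> u $ j" for j using m[of j] m1 by (simp add: u_def field_simps)
  have us: "(\<Sum>j\<in>UNIV. u $ j) = 1 - 1 / m"
    using prob_simplexD(3)[OF x] prob_simplexD(3)[OF y]
    by (simp add: u_def sum_subtractf sum_divide_distrib[symmetric])
  have fu: "f u $ i = f x $ i - f y $ i / m"
    by (simp add: u_def linear_diff[OF lin] linear_scale[OF lin])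
  have fy: "0 \<le> f y $ i" "f y $ i \<le> 1"
    using nonneg[of y] upper[OF y] prob_simplexD[OF y] by auto
  have "\<epsilon> * (1 - 1 / m) * f y $ i \<le> f u $ i"
  proof (cases "m = 1")
    case True
    then show ?thesis using nonneg[OF u0] by simp
  next
    case False
    with m1 have k: "0 < 1 - 1 / m" by simp
    have "(1 / (1 - 1 / m)) *\<^sub>R u \<in> prob_simplex"
      using u0 us k False m1 by (intro prob_simplexI) (simp_all add: sum_divide_distrib[symmetric])
    from lower[OF this, of i] have "\<epsilon> \<le> f u $ i / (1 - 1 / m)"
      by (simp add: linear_scale[OF lin])
    then have "\<epsilon> * (1 - 1 / m) \<le> f u $ i" using k by (simp add: pos_le_divide_eq)
    \<comment> \<open>The bound f y \<le> 1 turns an absolute lower bound into one relative to f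
      y.\<close>
    moreover have "\<epsilon> * (1 - 1 / m) * f y $ i \<le> \<epsilon> * (1 - 1 / m) * 1"
      using fy k \<epsilon> by (intro mult_left_mono mult_nonneg_nonneg) auto
    ultimately show ?thesis by simp
  qed
  \<comment> \<open>Adding f y / m makes the coefficient of f y the mean of 1 / m and 1 with weights
    1 - \<epsilon> and \<epsilon>.\<close>
  then have low: "((1 - \<epsilon>) * (1 / m) + \<epsilon> * 1) * f y $ i \<le> f x $ i"
    unfolding fu by (simp add: algebra_simps diff_divide_distrib)
  have "m powr (- (1 - \<epsilon>)) = (1 / m) powr (1 - \<epsilon>) * 1 powr \<epsilon>"
    unfolding powr_minus_divide using m1 by (simp add: powr_divide)
  also have "\<dots> \<le> (1 - \<epsilon>) * (1 / m) + \<epsilon> * 1"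
    using m1 \<epsilon> by (intro Youngs_inequality_0) auto
  finally have "m powr (- (1 - \<epsilon>)) * f y $ i \<le> f x $ i"
    using mult_right_mono[OF _ fy(1)] low order_trans by blast
  then have "m powr (1 - \<epsilon>) * (m powr (- (1 - \<epsilon>)) * f y $ i) \<le> m powr (1 - \<epsilon>) * f x $ i"
    by (intro mult_left_mono) auto
  moreover have "m powr (1 - \<epsilon>) * (m powr (- (1 - \<epsilon>)) * f y $ i) = f y $ i"
    using m1 by (simp add: mult.assoc[symmetric] flip: powr_add)
  ultimately show ?thesis by (simp only:)
qed

text \<open>What the attractor argument takes from the differential equation. Linearity is asked on
  the whole space because the contraction estimate applies the flow to x - y / m; \<epsilon> is the
  same for all \<open>\<omega>\<close>.\<close>

locale positive_linear_cocycle =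
  fixes W :: "'w set" and \<theta> :: "real \<Rightarrow> 'w \<Rightarrow> 'w"
    and \<phi> :: "real \<Rightarrow> 'w \<Rightarrow> real ^ 'n::finite \<Rightarrow> real ^ 'n" and \<epsilon> :: real
  assumes shift_in: "\<And>t \<omega>. \<omega> \<in> W \<Longrightarrow> \<theta> t \<omega> \<in> W"
    and shift_0: "\<And>\<omega>. \<omega> \<in> W \<Longrightarrow> \<theta> 0 \<omega> = \<omega>"
    and shift_plus: "\<And>s t \<omega>. \<omega> \<in> W \<Longrightarrow> \<theta> t (\<theta> s \<omega>) = \<theta> (t + s) \<omega>"
    and flow_linear: "\<And>t \<omega>. 0 \<le> t \<Longrightarrow> \<omega> \<in> W \<Longrightarrow> linear (\<phi> t \<omega>)"
    and flow_0: "\<And>\<omega> x. \<omega> \<in> W \<Longrightarrow> \<phi> 0 \<omega> x = x"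
    and flow_plus: "\<And>s t \<omega> x. 0 \<le> t \<Longrightarrow> 0 \<le> s \<Longrightarrow> \<omega> \<in> W \<Longrightarrow> \<phi> (t + s) \<omega> x = \<phi> s (\<theta> t \<omega>) (\<phi> t \<omega> x)"
    and flow_nonneg: "\<And>t \<omega> x i. 0 \<le> t \<Longrightarrow> \<omega> \<in> W \<Longrightarrow> (\<And>j. 0 \<le> x $ j) \<Longrightarrow> 0 \<le> \<phi> t \<omega> x $ i"
    and flow_simplex: "\<And>t \<omega> x. 0 \<le> t \<Longrightarrow> \<omega> \<in> W \<Longrightarrow> x \<in> prob_simplex \<Longrightarrow> \<phi> t \<omega> x \<in> prob_simplex"
    and flow_lower: "\<And>\<omega> x i. \<omega> \<in> W \<Longrightarrow> x \<in> prob_simplex \<Longrightarrow> \<epsilon> \<le> \<phi> 1 \<omega> x $ i"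
    and eps: "0 < \<epsilon>" "\<epsilon> \<le> 1"
begin

section \<open>Contraction, dissipativity and the pullback limit for positive linear
  cocycles\<close>

lemma is_cocycle: "is_cocycle W \<theta> prob_simplex \<phi>"
  unfolding is_cocycle_def using flow_simplex flow_0 flow_plus by blast

text \<open>The last unit of time alone produces the lower bound, whatever the state before
  it.\<close>

lemma flow_lower_ge_1:
  assumes t: "1 \<le> t" and \<omega>: "\<omega> \<in> W" and x: "x \<in> prob_simplex"
  shows "\<epsilon> \<le> \<phi> t \<omega> x $ i"
proof -
  have "\<phi> t \<omega> x = \<phi> 1 (\<theta> (t - 1) \<omega>) (\<phi> (t - 1) \<omega> x)"
    using flow_plus[of "t - 1" 1 \<omega> x] t \<omega> by simp
  then show ?thesis using flow_lower[OF shift_in[OF \<omega>] flow_simplex[OF _ \<omega> x]] t by simp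
qed

lemma flow_dominating_factor:
  assumes \<omega>: "\<omega> \<in> W" and x: "x \<in> prob_simplex" and y: "y \<in> prob_simplex" and m: "\<And>i. y $ i \<le> m * x $ i"
  shows "\<phi> 1 \<omega> y $ i \<le> m powr (1 - \<epsilon>) * \<phi> 1 \<omega> x $ i"
proof (rule dominating_factor_contraction[OF _ _ _ _ eps x y m])
  show "linear (\<phi> 1 \<omega>)" using \<omega> by (intro flow_linear) auto
  show "\<And>v i. (\<And>j. 0 \<le> v $ j) \<Longrightarrow> 0 \<le> \<phi> 1 \<omega> v $ i" using \<omega> by (intro flow_nonneg) auto
  show "\<And>v i. v \<in> prob_simplex \<Longrightarrow> \<epsilon> \<le> \<phi> 1 \<omega> v $ i" by (rule flow_lower[OF \<omega>])
  show "\<And>v i. v \<in> prob_simplex \<Longrightarrow> \<phi> 1 \<omega> v $ i \<le> 1"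
    using prob_simplexD(2)[OF flow_simplex[OF _ \<omega>]] by simp
qed

lemma uniformly_contractive: "uniformly_contractive W prob_simplex hilbert_metric \<phi>"
  unfolding uniformly_contractive_def
proof (rule exI[of _ 1], intro exI[of _ "1 - \<epsilon>"] conjI ballI impI)
  fix \<omega> and x y :: "real ^ 'n" assume \<omega>: "\<omega> \<in> W" and x: "x \<in> prob_simplex" and y: "y \<in> prob_simplex"
    and fin: "hilbert_metric x y < \<infinity>"
  obtain m m' where m: "1 \<le> m" "1 \<le> m'" "\<And>i. y $ i \<le> m * x $ i" "\<And>i. x $ i \<le> m' * y $ i"
    and hm: "hilbert_metric x y = ereal (ln m + ln m')"
    using hilbert_metric_finiteE[OF x y fin] by metis
  have "hilbert_metric (\<phi> 1 \<omega> x) (\<phi> 1 \<omega> y) \<le> ereal (ln (m powr (1 - \<epsilon>)) + ln (m' powr (1 - \<epsilon>)))"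
    using \<omega> x y m by (intro hilbert_metric_le flow_simplex flow_dominating_factor) auto
  also have "\<dots> = ereal (1 - \<epsilon>) * hilbert_metric x y"
    using m by (simp add: hm ln_powr algebra_simps)
  finally show "hilbert_metric (\<phi> 1 \<omega> x) (\<phi> 1 \<omega> y) \<le> ereal (1 - \<epsilon>) * hilbert_metric x y" .
qed (use eps in auto)

text \<open>The common dominating factor after time k + 1: one unit brings all entries between
  \<epsilon> and 1, hence 1 / \<epsilon>; each of the other k units takes the power 1 -
  \<epsilon>.\<close>

definition factor :: "nat \<Rightarrow> real" where
  "factor k = (1 / \<epsilon>) powr ((1 - \<epsilon>) ^ k)"

lemma factor_pos: "0 < factor k"
  using eps by (simp add: factor_def)

text \<open>Induction by splitting off the last unit of time. No finite distance is required at the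
  start, since the base case already makes any two points comparable.\<close>

lemma flow_factor:
  assumes "real k + 1 \<le> t" and "\<omega> \<in> W" "x \<in> prob_simplex" "y \<in> prob_simplex"
  shows "\<phi> t \<omega> y $ i \<le> factor k * \<phi> t \<omega> x $ i"
  using assms
proof (induction k arbitrary: t i)
  case 0
  have "\<phi> t \<omega> y $ i \<le> 1"
    using 0 by (intro prob_simplexD(2) flow_simplex) auto
  also have "\<dots> = (1 / \<epsilon>) * \<epsilon>" using eps by simp
  also have "\<dots> \<le> (1 / \<epsilon>) * \<phi> t \<omega> x $ i"
    using 0 eps by (intro mult_left_mono flow_lower_ge_1) auto
  also have "\<dots> = factor 0 * \<phi> t \<omega> x $ i" using eps by (simp add: factor_def)
  finally show ?case .
next
  case (Suc k)
  have t: "0 \<le> t - 1" "real k + 1 \<le> t - 1" using Suc.prems by auto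
  have eq: "\<phi> t \<omega> z = \<phi> 1 (\<theta> (t - 1) \<omega>) (\<phi> (t - 1) \<omega> z)" for z
    using flow_plus[of "t - 1" 1 \<omega> z] t Suc.prems by simp
  have "\<phi> t \<omega> y $ i \<le> factor k powr (1 - \<epsilon>) * \<phi> t \<omega> x $ i"
    unfolding eq using Suc t by (intro flow_dominating_factor shift_in flow_simplex Suc.IH) auto
  then show ?case by (simp add: factor_def powr_powr mult.commute)
qed

lemma ln_factor_tendsto: "(\<lambda>k. ln (factor k)) \<longlonglongrightarrow> 0"
proof -
  have "(\<lambda>k. (1 - \<epsilon>) ^ k * ln (1 / \<epsilon>)) \<longlonglongrightarrow> 0 * ln (1 / \<epsilon>)"
    using eps by (intro tendsto_intros LIMSEQ_power_zero) auto
  then show ?thesis using eps by (simp add: factor_def ln_powr)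
qed

lemma factor_tendsto: "factor \<longlonglongrightarrow> 1"
proof -
  have "(\<lambda>k. exp (ln (factor k))) \<longlonglongrightarrow> exp 0"
    by (intro tendsto_exp ln_factor_tendsto)
  then show ?thesis using factor_pos by simp
qed

text \<open>Entries between \<epsilon> and 1 have ratios at most 1 / \<epsilon>, so the absorbing
  set has diameter at most 2 * ln (1 / \<epsilon>).\<close>

lemma uniformly_dissipative: "uniformly_dissipative W prob_simplex hilbert_metric \<phi>"
proof -
  let ?S = "{x \<in> prob_simplex. \<forall>i. \<epsilon> \<le> (x :: real ^ 'n) $ i}"
  have "hilbert_metric x y \<le> ereal (ln (1 / \<epsilon>) + ln (1 / \<epsilon>))" if "x \<in> ?S" "y \<in> ?S" for x y
  proof -
    have *: "v $ i \<le> 1 / \<epsilon> * u $ i" if "v \<in> prob_simplex" "\<forall>i. \<epsilon> \<le> u $ i" for u v :: "real ^ 'n" and i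
      using that prob_simplexD(2)[OF that(1), of i] order_trans[of "v $ i" 1 "u $ i / \<epsilon>"] eps by simp
    show ?thesis using that by (intro hilbert_metric_le *) auto
  qed
  then have "metric_bounded hilbert_metric ?S"
    unfolding metric_bounded_def by blast
  moreover have "\<forall>\<omega>\<in>W. \<phi> 1 \<omega> ` prob_simplex \<subseteq> ?S"
    using flow_simplex flow_lower by auto
  ultimately show ?thesis
    unfolding uniformly_dissipative_def
    using metric_closed_in_lower_bound[of \<epsilon>] zero_le_one[where 'a = real] by blast
qed

text \<open>Domination in both directions, with entries at most 1, bounds each coordinate of the
  difference; the dimension enters through the l1 norm. The bound is uniform in the fibre and in
  both starting points.\<close>

lemma norm_flow_diff_le:
  assumes "real k + 1 \<le> t" and "\<omega> \<in> W" "x \<in> prob_simplex" "y \<in> prob_simplex"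
  shows "norm (\<phi> t \<omega> x - \<phi> t \<omega> y) \<le> CARD('n) * (factor k - 1)"
proof -
  have "\<bar>(\<phi> t \<omega> x - \<phi> t \<omega> y) $ i\<bar> \<le> factor k - 1" for i
  proof -
    have le: "\<phi> t \<omega> u $ i - \<phi> t \<omega> v $ i \<le> factor k - 1" if u: "u \<in> prob_simplex" and v: "v \<in> prob_simplex" for u v
    proof -
      have V: "\<phi> t \<omega> v \<in> prob_simplex" "\<phi> t \<omega> u \<in> prob_simplex"
        using u v assms by (auto intro!: flow_simplex)
      have f1: "1 \<le> factor k"
        using dominating_factor_ge_1[OF V] flow_factor[OF assms(1,2) v u] by blast
      have "\<phi> t \<omega> u $ i - \<phi> t \<omega> v $ i \<le> (factor k - 1) * \<phi> t \<omega> v $ i"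
        using flow_factor[OF assms(1,2) v u, of i] by (simp add: algebra_simps)
      also have "\<dots> \<le> (factor k - 1) * 1"
        using f1 prob_simplexD(2)[OF V(1)] by (intro mult_left_mono) auto
      finally show ?thesis by simp
    qed
    show ?thesis using le[of x y] le[of y x] assms by (simp add: abs_le_iff)
  qed
  then have "(\<Sum>i\<in>UNIV. \<bar>(\<phi> t \<omega> x - \<phi> t \<omega> y) $ i\<bar>) \<le> (\<Sum>i::'n\<in>UNIV. factor k - 1)"
    by (intro sum_mono)
  then show ?thesis
    using norm_le_l1_cart[of "\<phi> t \<omega> x - \<phi> t \<omega> y"] by simp
qed

lemma norm_bound_tendsto: "(\<lambda>k. CARD('n) * (factor k - 1)) \<longlonglongrightarrow> 0"
proof -
  have "(\<lambda>k. CARD('n) * (factor k - 1)) \<longlonglongrightarrow> real CARD('n) * (1 - 1)"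
    by (intro tendsto_intros factor_tendsto)
  then show ?thesis by simp
qed

text \<open>A starting point independent of \<open>\<omega>\<close>, so that the pullbacks are
  measurable in \<open>\<omega>\<close>.\<close>

definition barycentre :: "real ^ 'n" where
  "barycentre = (\<chi> i. 1 / CARD('n))"

lemma barycentre_simplex: "barycentre \<in> prob_simplex"
  by (rule prob_simplexI) (auto simp: barycentre_def)

text \<open>Integer times only: the attractor point is then the limit of a sequence, which preserves
  measurability.\<close>

definition pullback :: "'w \<Rightarrow> nat \<Rightarrow> real ^ 'n" where
  "pullback \<omega> n = \<phi> n (\<theta> (- real n) \<omega>) barycentre"

definition attractor_point :: "'w \<Rightarrow> real ^ 'n" where
  "attractor_point \<omega> = lim (pullback \<omega>)"

lemma pullback_simplex: "\<omega> \<in> W \<Longrightarrow> pullback \<omega> n \<in> prob_simplex"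
  unfolding pullback_def by (intro flow_simplex shift_in barycentre_simplex) auto

lemma pullback_tendsto:
  assumes \<omega>: "\<omega> \<in> W"
  shows "pullback \<omega> \<longlonglongrightarrow> attractor_point \<omega>"
proof -
  \<comment> \<open>Flowing from time -m to time -n first exhibits both pullbacks as runs of length
    n in the same fibre, from two points of the simplex.\<close>
  have split: "pullback \<omega> m = \<phi> n (\<theta> (- real n) \<omega>) (\<phi> (real m - real n) (\<theta> (- real m) \<omega>) barycentre)"
    if "n \<le> m" for m n
  proof -
    have "\<theta> (real m - real n) (\<theta> (- real m) \<omega>) = \<theta> (- real n) \<omega>"
      using \<omega> by (simp add: shift_plus)
    then show ?thesis
      unfolding pullback_def
      using flow_plus[of "real m - real n" "real n" "\<theta> (- real m) \<omega>" barycentre] that \<omega> by (simp add: shift_in)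
  qed
  have d: "norm (pullback \<omega> m - pullback \<omega> n) \<le> CARD('n) * (factor k - 1)" if "Suc k \<le> n" "n \<le> m" for k m n
    unfolding split[OF that(2)] unfolding pullback_def[of \<omega> n] using that \<omega>
    by (intro norm_flow_diff_le shift_in flow_simplex barycentre_simplex) auto
  have "Cauchy (pullback \<omega>)"
    unfolding Cauchy_altdef2
  proof (intro allI impI)
    fix e :: real assume "0 < e"
    then obtain k where k: "CARD('n) * (factor k - 1) < e"
      using order_tendstoD(2)[OF norm_bound_tendsto] by (auto simp: eventually_sequentially)
    show "\<exists>N. \<forall>n\<ge>N. dist (pullback \<omega> n) (pullback \<omega> N) < e"
      using le_less_trans[OF d k] by (intro exI[of _ "Suc k"]) (auto simp: dist_norm)
  qed
  then show ?thesis
    unfolding attractor_point_def by (simp add: Cauchy_convergent convergent_LIMSEQ_iff[symmetric])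
qed

lemma attractor_point_simplex: "\<omega> \<in> W \<Longrightarrow> attractor_point \<omega> \<in> prob_simplex"
  using closed_sequentially[OF closed_prob_simplex pullback_simplex pullback_tendsto] .

lemma attractor_point_invariant:
  assumes \<omega>: "\<omega> \<in> W" and t: "0 \<le> t"
  shows "\<phi> t \<omega> (attractor_point \<omega>) = attractor_point (\<theta> t \<omega>)"
proof -
  have "(\<lambda>n. \<phi> t \<omega> (pullback \<omega> n)) \<longlonglongrightarrow> \<phi> t \<omega> (attractor_point \<omega>)"
    using linear_conv_bounded_linear flow_linear[OF t \<omega>] pullback_tendsto[OF \<omega>] bounded_linear.tendsto by blast
  \<comment> \<open>Both terms are runs of length n from time t - n to time t in one fibre; only the
    starting points differ. A run of length n = (n - 1) + 1 has factor index n - 1.\<close>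
  moreover have "(\<lambda>n. \<phi> t \<omega> (pullback \<omega> n) - pullback (\<theta> t \<omega>) n) \<longlonglongrightarrow> 0"
  proof (rule Lim_null_comparison)
    show "(\<lambda>n. CARD('n) * (factor (n - 1) - 1)) \<longlonglongrightarrow> 0"
      by (rule LIMSEQ_offset[of _ 1]) (simp add: norm_bound_tendsto)
    have "norm (\<phi> t \<omega> (pullback \<omega> n) - pullback (\<theta> t \<omega>) n) \<le> CARD('n) * (factor (n - 1) - 1)" if n: "1 \<le> n" for n
    proof -
      let ?\<omega> = "\<theta> (- real n) \<omega>"
      have w: "?\<omega> \<in> W" "\<theta> t ?\<omega> \<in> W" using \<omega> by (auto intro: shift_in)
      have "\<phi> t \<omega> (pullback \<omega> n) = \<phi> (real n + t) ?\<omega> barycentre"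
        using flow_plus[of "real n" t ?\<omega> barycentre] t \<omega> w by (simp add: pullback_def shift_plus shift_0)
      also have "\<dots> = \<phi> n (\<theta> t ?\<omega>) (\<phi> t ?\<omega> barycentre)"
        using flow_plus[of t "real n" ?\<omega> barycentre] t w by (simp add: add.commute)
      finally have eq: "\<phi> t \<omega> (pullback \<omega> n) = \<phi> n (\<theta> t ?\<omega>) (\<phi> t ?\<omega> barycentre)" .
      have "\<theta> (- real n) (\<theta> t \<omega>) = \<theta> t ?\<omega>"
        using \<omega> by (simp add: shift_plus)
      then have eq': "pullback (\<theta> t \<omega>) n = \<phi> n (\<theta> t ?\<omega>) barycentre"
        by (simp add: pullback_def)
      show ?thesis
        unfolding eq eq' using n w t
        by (intro norm_flow_diff_le flow_simplex barycentre_simplex) (auto simp: of_nat_diff)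
    qed
    then show "\<forall>\<^sub>F n in sequentially. norm (\<phi> t \<omega> (pullback \<omega> n) - pullback (\<theta> t \<omega>) n) \<le> CARD('n) * (factor (n - 1) - 1)"
      by (auto simp: eventually_sequentially)
  qed
  then have "(\<lambda>n. pullback (\<theta> t \<omega>) n + (\<phi> t \<omega> (pullback \<omega> n) - pullback (\<theta> t \<omega>) n)) \<longlonglongrightarrow> attractor_point (\<theta> t \<omega>) + 0"
    by (intro tendsto_add pullback_tendsto shift_in \<omega>)
  ultimately show ?thesis by (simp add: LIMSEQ_unique)
qed

lemma attractor_point_norm:
  assumes "real k + 1 \<le> t" "\<omega> \<in> W" "x \<in> prob_simplex"
  shows "norm (\<phi> t \<omega> x - attractor_point (\<theta> t \<omega>)) \<le> CARD('n) * (factor k - 1)"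
  using norm_flow_diff_le[OF assms(1,2,3) attractor_point_simplex[OF assms(2)]]
    attractor_point_invariant[OF assms(2), of t] assms(1) by simp

lemma attractor_point_hilbert:
  assumes "real k + 1 \<le> t" "\<omega> \<in> W" "x \<in> prob_simplex"
  shows "hilbert_metric (\<phi> t \<omega> x) (attractor_point (\<theta> t \<omega>)) \<le> ereal (2 * ln (factor k))"
proof -
  have t: "0 \<le> t" using assms(1) by simp
  note a = attractor_point_simplex[OF assms(2)]
  have "hilbert_metric (\<phi> t \<omega> x) (\<phi> t \<omega> (attractor_point \<omega>)) \<le> ereal (ln (factor k) + ln (factor k))"
    using assms a t by (intro hilbert_metric_le flow_factor flow_simplex) auto
  then show ?thesis using attractor_point_invariant[OF assms(2) t] by simp
qed

text \<open>The largest k with k + 1 \<le> t, for t \<ge> 1, converts the bounds indexed by integers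
  into limits over real time.\<close>

lemma time_index_at_top: "filterlim (\<lambda>t::real. nat \<lfloor>t\<rfloor> - 1) sequentially at_top"
  unfolding filterlim_at_top eventually_at_top_linorder
proof
  fix Z :: nat
  show "\<exists>N. \<forall>t\<ge>N. Z \<le> nat \<lfloor>t :: real\<rfloor> - 1"
    by (rule exI[of _ "real Z + 1"]) (auto simp: le_nat_iff le_diff_conv2 le_floor_iff nat_le_iff)
qed

lemma time_index: "1 \<le> t \<Longrightarrow> real (nat \<lfloor>t\<rfloor> - 1) + 1 \<le> t"
  by (simp add: of_nat_diff le_nat_iff)

lemma attractor_point_stable:
  assumes "\<omega> \<in> W" "x \<in> prob_simplex"
  shows "((\<lambda>t. \<phi> t \<omega> x - attractor_point (\<theta> t \<omega>)) \<longlongrightarrow> 0) at_top"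
proof (rule Lim_null_comparison)
  show "((\<lambda>t::real. CARD('n) * (factor (nat \<lfloor>t\<rfloor> - 1) - 1)) \<longlongrightarrow> 0) at_top"
    using filterlim_compose[OF norm_bound_tendsto time_index_at_top] .
  show "\<forall>\<^sub>F t in at_top. norm (\<phi> t \<omega> x - attractor_point (\<theta> t \<omega>)) \<le> CARD('n) * (factor (nat \<lfloor>t\<rfloor> - 1) - 1)"
    using eventually_ge_at_top[of 1] by eventually_elim (intro attractor_point_norm time_index assms)
qed

text \<open>The bound 2 * ln (factor k) holds at every point of every fibre, so it survives the
  supremum over a set that varies with t.\<close>

lemma attractor_point_pullback:
  assumes \<omega>: "\<omega> \<in> W" and D: "\<And>\<omega>. \<omega> \<in> W \<Longrightarrow> D \<omega> \<noteq> {} \<and> D \<omega> \<subseteq> prob_simplex"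
  shows "((\<lambda>t. semi_dist hilbert_metric (\<phi> t (\<theta> (- t) \<omega>) ` D (\<theta> (- t) \<omega>)) {attractor_point \<omega>}) \<longlongrightarrow> 0) at_top"
proof (rule tendsto_sandwich)
  let ?s = "\<lambda>t. semi_dist hilbert_metric (\<phi> t (\<theta> (- t) \<omega>) ` D (\<theta> (- t) \<omega>)) {attractor_point \<omega>}"
  have s: "?s t = (SUP x\<in>D (\<theta> (- t) \<omega>). hilbert_metric (\<phi> t (\<theta> (- t) \<omega>) x) (attractor_point \<omega>))" for t
    by (simp add: semi_dist_def image_image)
  show "((\<lambda>t::real. 0) \<longlongrightarrow> (0::ereal)) at_top" by simp
  show "\<forall>\<^sub>F t in at_top. 0 \<le> ?s t"
    using eventually_ge_at_top[of 0]
  proof eventually_elim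
    case (elim t)
    \<comment> \<open>Nonemptiness matters: the supremum of an empty family in the extended reals is
      minus infinity.\<close>
    obtain x where x: "x \<in> D (\<theta> (- t) \<omega>)" "x \<in> prob_simplex" using D[OF shift_in[OF \<omega>]] by blast
    have "0 \<le> hilbert_metric (\<phi> t (\<theta> (- t) \<omega>) x) (attractor_point \<omega>)"
      using elim x \<omega> by (intro hilbert_metric_nonneg flow_simplex shift_in attractor_point_simplex)
    also have "\<dots> \<le> ?s t" unfolding s by (rule SUP_upper[OF x(1)])
    finally show ?case .
  qed
  show "\<forall>\<^sub>F t in at_top. ?s t \<le> ereal (2 * ln (factor (nat \<lfloor>t\<rfloor> - 1)))"
    using eventually_ge_at_top[of 1]
  proof eventually_elim
    case (elim t)
    have "\<theta> t (\<theta> (- t) \<omega>) = \<omega>" using \<omega> by (simp add: shift_plus shift_0)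
    then show ?case
      unfolding s using attractor_point_hilbert[OF time_index[OF elim] shift_in[OF \<omega>, of "- t"]] D[OF shift_in[OF \<omega>]]
      by (intro SUP_least) (auto simp: subset_iff)
  qed
  have "((\<lambda>t::real. 2 * ln (factor (nat \<lfloor>t\<rfloor> - 1))) \<longlongrightarrow> 2 * 0) at_top"
    by (intro tendsto_mult tendsto_const filterlim_compose[OF ln_factor_tendsto time_index_at_top])
  then show "((\<lambda>t::real. ereal (2 * ln (factor (nat \<lfloor>t\<rfloor> - 1)))) \<longlongrightarrow> 0) at_top"
    by (simp add: zero_ereal_def)
qed

end

section \<open>The random rate equation\<close>

text \<open>The half of norm equivalence that makes \<open>nrm\<close> Lipschitz, hence continuous;
  the constant is the sum of the norms of the unit vectors.\<close>

lemma is_norm_le_norm: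
  fixes nrm :: "real ^ 'n::finite \<Rightarrow> real"
  assumes "is_norm nrm"
  shows "\<exists>k\<ge>0. \<forall>x. nrm x \<le> k * norm x"
proof (intro exI conjI allI)
  have nn: "0 \<le> nrm x" and sc: "nrm (a *\<^sub>R x) = \<bar>a\<bar> * nrm x" and tri: "nrm (x + y) \<le> nrm x + nrm y"
    and z: "nrm 0 = 0" for x y a
    using assms by (auto simp: is_norm_def)
  have sum: "nrm (\<Sum>i\<in>I. g i) \<le> (\<Sum>i\<in>I. nrm (g i))" if "finite I" for I :: "'n set" and g
    using that by induction (auto simp: z intro: order_trans[OF tri])
  let ?k = "\<Sum>i\<in>UNIV. nrm (axis i 1)"
  show "0 \<le> ?k" by (intro sum_nonneg nn)
  fix x :: "real ^ 'n"
  have "nrm x = nrm (\<Sum>i\<in>UNIV. x $ i *\<^sub>R axis i 1)"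
    using basis_expansion[of x] by (simp add: scalar_mult_eq_scaleR)
  also have "\<dots> \<le> (\<Sum>i\<in>UNIV. \<bar>x $ i\<bar> * nrm (axis i 1))"
    using sum[of UNIV "\<lambda>i. x $ i *\<^sub>R axis i 1"] by (simp add: sc)
  also have "\<dots> \<le> (\<Sum>i\<in>UNIV. norm x * nrm (axis i 1))"
    by (intro sum_mono mult_right_mono nn component_le_norm_cart)
  also have "\<dots> = ?k * norm x" by (subst mult.commute) (rule sum_distrib_left[symmetric])
  finally show "nrm x \<le> ?k * norm x" .
qed

lemma is_norm_continuous_on:
  fixes nrm :: "real ^ 'n::finite \<Rightarrow> real"
  assumes "is_norm nrm"
  shows "continuous_on UNIV nrm"
proof -
  obtain k where k: "0 \<le> k" "\<And>x. nrm x \<le> k * norm x" using is_norm_le_norm[OF assms] by blast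
  have tri: "nrm (x + y) \<le> nrm x + nrm y" for x y using assms by (auto simp: is_norm_def)
  have "dist (nrm x) (nrm y) \<le> k * dist x y" for x y
    using tri[of "x - y" y] tri[of "y - x" x] k(2)[of "x - y"] k(2)[of "y - x"]
    by (simp add: dist_norm norm_minus_commute abs_le_iff)
  then have "k-lipschitz_on UNIV nrm" using k(1) by (intro lipschitz_onI) auto
  then show ?thesis by (rule lipschitz_on_continuous_on)
qed

text \<open>The parameter \<open>dim\<close> carries the index type, which the other parameters do
  not mention.\<close>

locale random_rate_equation = metric_dynamical_system M \<theta>
  for M :: "'w measure" and \<theta> :: "real \<Rightarrow> 'w \<Rightarrow> 'w" +
  fixes q :: "nat \<Rightarrow> 'w \<Rightarrow> real" and c C :: real and dim :: "'n::{finite,linorder} itself"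
  assumes card: "2 \<le> CARD('n)"
    and q_meas: "\<And>i. i \<in> {1..2 * CARD('n) - 2} \<Longrightarrow> q i \<in> borel_measurable M"
    and c: "0 < c"
    and q_bounds: "\<And>i \<omega>. i \<in> {1..2 * CARD('n) - 2} \<Longrightarrow> \<omega> \<in> space M \<Longrightarrow> c \<le> q i \<omega> \<and> q i \<omega> \<le> C"
begin

abbreviation Q :: "'w \<Rightarrow> real ^ 'n::{finite,linorder} ^ 'n::{finite,linorder}" where
  "Q \<omega> \<equiv> rate_matrix (\<lambda>i. q i \<omega>)"

lemma shift_measurable: "\<theta> t \<in> M \<rightarrow>\<^sub>M M"
  using measurable_compose[OF measurable_Pair1' joint_measurable, of t] by simp

lemma shift_in_space: "\<omega> \<in> space M \<Longrightarrow> \<theta> t \<omega> \<in> space M"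
  using measurable_space[OF shift_measurable] .

text \<open>Measurability of \<open>q i\<close> is known only for indices in range, so the case of
  the matrix entry is decided before measurability is invoked.\<close>

lemma Q_measurable: "(\<lambda>\<omega>. Q \<omega> $ i $ j) \<in> borel_measurable M"
proof -
  have q1: "q 1 \<in> borel_measurable M" and qN: "q (2 * CARD('n) - 2) \<in> borel_measurable M"
    using card by (auto intro!: q_meas)
  have qj: "q (2 * pos j - 1) \<in> borel_measurable M" if "pos i = pos j + 1"
    by (rule q_meas[OF rate_index(1)[OF that]])
  have qi': "q (2 * pos i) \<in> borel_measurable M" if "pos j = pos i + 1"
    by (rule q_meas[OF rate_index(2)[OF that]])
  have qi: "q (2 * pos i - 2) \<in> borel_measurable M" "q (2 * pos i - 1) \<in> borel_measurable M"
    if "pos i \<noteq> 1" "pos i \<noteq> CARD('n)"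
    using that pos_ge_1[of i] pos_le_card[of i] by (intro q_meas; simp; linarith)+
  consider "pos i = pos j + 1" | "pos j = pos i + 1" | "i = j" "pos i = 1" | "i = j" "pos i \<noteq> 1" "pos i = CARD('n)"
    | "i = j" "pos i \<noteq> 1" "pos i \<noteq> CARD('n)" | "pos i \<noteq> pos j + 1" "pos j \<noteq> pos i + 1" "i \<noteq> j"
    by blast
  then show ?thesis
  proof cases
    case 1
    then have "(\<lambda>\<omega>. Q \<omega> $ i $ j) = q (2 * pos j - 1)" by (simp add: rate_matrix_def)
    with qj 1 show ?thesis by simp
  next
    case 2
    then have "(\<lambda>\<omega>. Q \<omega> $ i $ j) = q (2 * pos i)" by (simp add: rate_matrix_def)
    with qi' 2 show ?thesis by simp
  next
    case 3
    then have "(\<lambda>\<omega>. Q \<omega> $ i $ j) = (\<lambda>\<omega>. - q 1 \<omega>)" by (simp add: rate_matrix_def)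
    then show ?thesis using borel_measurable_uminus[OF q1] by (simp only:)
  next
    case 4
    then have "(\<lambda>\<omega>. Q \<omega> $ i $ j) = (\<lambda>\<omega>. - q (2 * CARD('n) - 2) \<omega>)" by (simp add: rate_matrix_def)
    then show ?thesis using borel_measurable_uminus[OF qN] by (simp only:)
  next
    case 5
    then have "(\<lambda>\<omega>. Q \<omega> $ i $ j) = (\<lambda>\<omega>. - (q (2 * pos i - 2) \<omega> + q (2 * pos i - 1) \<omega>))"
      by (simp add: rate_matrix_def)
    then show ?thesis
      using borel_measurable_uminus[OF borel_measurable_add[OF qi[OF 5(2,3)]]] by (simp only:)
  next
    case 6
    then have "(\<lambda>\<omega>. Q \<omega> $ i $ j) = (\<lambda>\<omega>. 0)" by (simp add: rate_matrix_def)
    then show ?thesis by simp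
  qed
qed

lemma Q_joint_measurable: "(\<lambda>(s, \<omega>). Q (\<theta> s \<omega>) $ i $ j) \<in> borel_measurable (borel \<Otimes>\<^sub>M M)"
  using measurable_compose[OF joint_measurable Q_measurable[of i j]] by (simp add: split_def)

lemma generator_path:
  assumes \<omega>: "\<omega> \<in> space M"
  shows "generator_path (\<lambda>s. Q (\<theta> s \<omega>)) c (2 * C)"
proof
  note b = q_bounds[OF _ shift_in_space[OF \<omega>]]
  show "(\<lambda>s. Q (\<theta> s \<omega>) $ i $ j) \<in> borel_measurable borel" for i j
    using measurable_compose[OF measurable_Pair2'[OF \<omega>] Q_joint_measurable[of i j]] by simp
  show "0 \<le> (Q (\<theta> s \<omega>) + (2 * C) *\<^sub>R mat 1) $ i $ j"
    "(Q (\<theta> s \<omega>) + (2 * C) *\<^sub>R mat 1) $ i $ j \<le> 2 * C" for s i j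
    by (rule rate_matrix_shifted[OF card c b]; assumption)+
  show "(\<Sum>i\<in>UNIV. Q (\<theta> s \<omega>) $ i $ j) = 0" for s j
    by (rule rate_matrix_column_sum[OF card])
  show "c \<le> Q (\<theta> s \<omega>) $ i $ j" if "pos i = pos j + 1 \<or> pos j = pos i + 1" for s i j
    by (rule rate_matrix_neighbour[OF card c b that]; assumption)
qed (rule c)

text \<open>The constant of \<open>solution_at_lower_bound\<close> for the shift 2 * C.\<close>

definition \<epsilon> :: real where
  "\<epsilon> = exp (- (2 * C)) * ((min 1 (c / CARD('n))) ^ CARD('n) / CARD('n))"

abbreviation \<phi> :: "real \<Rightarrow> 'w \<Rightarrow> real ^ 'n::{finite,linorder} \<Rightarrow> real ^ 'n::{finite,linorder}" where
  "\<phi> \<equiv> rde_flow \<theta> q"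

text \<open>The solution restarted at time \<open>t\<close> solves the equation of the fibre
  \<open>\<theta> t \<omega>\<close>, by the group law of \<open>\<theta>\<close>; uniqueness does
  the rest.\<close>

lemma flow_cocycle:
  assumes t: "0 \<le> t" and s: "0 \<le> s" and \<omega>: "\<omega> \<in> space M"
  shows "\<phi> (t + s) \<omega> x = \<phi> s (\<theta> t \<omega>) (\<phi> t \<omega> x)"
proof -
  interpret G: generator_path "\<lambda>s. Q (\<theta> s \<omega>)" c "2 * C"
    by (rule generator_path[OF \<omega>])
  interpret H: generator_path "\<lambda>s. Q (\<theta> s (\<theta> t \<omega>))" c "2 * C"
    by (rule generator_path[OF shift_in_space[OF \<omega>]])
  have "integral_solution (\<lambda>s. Q (\<theta> s (\<theta> t \<omega>))) (\<phi> t \<omega> x) (\<lambda>s. \<phi> (s + t) \<omega> x)"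
    using integral_solution_shift[OF G.integral_solution_solution_at[of x] t] \<omega>
    by (simp add: shift_add rde_flow_def)
  from H.solution_at_eqI[OF this s] show ?thesis
    by (simp add: rde_flow_def add.commute)
qed

lemma \<epsilon>_pos: "0 < \<epsilon>"
  using c by (simp add: \<epsilon>_def)

lemma \<epsilon>_le_1: "\<epsilon> \<le> 1"
proof -
  have "1 \<in> {1..2 * CARD('n) - 2}" using card by auto
  \<comment> \<open>The bounds on \<open>q\<close> yield C \<ge> 0 only at an actual sample point; a
    probability space has one.\<close>
  moreover obtain \<omega> where "\<omega> \<in> space M" using not_empty by blast
  ultimately have "0 \<le> C" using q_bounds[of 1 \<omega>] c by linarith
  moreover have "(min 1 (c / CARD('n))) ^ CARD('n) / CARD('n) \<le> 1 / 1"
    using c card by (intro frac_le power_le_one) auto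
  ultimately show ?thesis
    using mult_mono[of "exp (- (2 * C))" 1 "(min 1 (c / CARD('n))) ^ CARD('n) / CARD('n)" 1] c
    by (simp add: \<epsilon>_def)
qed

sublocale flow: positive_linear_cocycle "space M" \<theta> \<phi> \<epsilon>
proof
  fix t :: real and \<omega> and x :: "real ^ 'n::{finite,linorder}" and i
  assume t: "0 \<le> t" and \<omega>: "\<omega> \<in> space M"
  interpret G: generator_path "\<lambda>s. Q (\<theta> s \<omega>)" c "2 * C"
    by (rule generator_path[OF \<omega>])
  have lin: "linear (\<phi> t \<omega>)"
    using G.solution_at_linear[OF t] by (simp add: rde_flow_def[abs_def])
  show "\<phi> t \<omega> (v + w) = \<phi> t \<omega> v + \<phi> t \<omega> w" "\<phi> t \<omega> (r *\<^sub>R v) = r *\<^sub>R \<phi> t \<omega> v" for v w r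
    using linear_add[OF lin] linear_scale[OF lin] by auto
  show "(\<And>j. 0 \<le> x $ j) \<Longrightarrow> 0 \<le> \<phi> t \<omega> x $ i"
    using G.solution_at_nonneg[OF _ t, of x i] by (simp add: rde_flow_def)
  show "x \<in> prob_simplex \<Longrightarrow> \<phi> t \<omega> x \<in> prob_simplex"
    using G.solution_at_simplex[OF _ t, of x] by (simp add: rde_flow_def)
next
  fix \<omega> and x :: "real ^ 'n::{finite,linorder}" and i
  assume \<omega>: "\<omega> \<in> space M"
  interpret G: generator_path "\<lambda>s. Q (\<theta> s \<omega>)" c "2 * C"
    by (rule generator_path[OF \<omega>])
  show "\<phi> 0 \<omega> x = x"
    using G.solution_at_0[of x] by (simp add: rde_flow_def)
  show "x \<in> prob_simplex \<Longrightarrow> \<epsilon> \<le> \<phi> 1 \<omega> x $ i"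
    using G.solution_at_lower_bound[of x i] by (simp add: rde_flow_def \<epsilon>_def)
qed (fact shift_in_space shift_zero shift_add flow_cocycle \<epsilon>_pos \<epsilon>_le_1)+

text \<open>The Picard formula replaces the definite description, about which nothing measurable can
  be said directly.\<close>

lemma flow_measurable:
  assumes t: "0 \<le> t"
  shows "(\<lambda>\<omega>. \<phi> t \<omega> x) \<in> borel_measurable M"
proof -
  let ?B = "\<lambda>\<omega> s. Q (\<theta> s \<omega>) + (2 * C) *\<^sub>R mat 1"
  have "(\<lambda>(s, \<omega>). ?B \<omega> s $ i $ j) \<in> borel_measurable (borel \<Otimes>\<^sub>M M)" for i j
    using Q_joint_measurable[of i j] by (simp add: split_def)
  from picard_solution_measurable[OF this]
  have "(\<lambda>\<omega>. exp (- (2 * C) * t) *\<^sub>R picard_solution (?B \<omega>) x t) \<in> borel_measurable M"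
    by (intro borel_measurable_scaleR borel_measurable_const)
  moreover have "\<phi> t \<omega> x = exp (- (2 * C) * t) *\<^sub>R picard_solution (?B \<omega>) x t" if "\<omega> \<in> space M" for \<omega>
    unfolding rde_flow_def using generator_path.solution_at_eq_picard[OF generator_path[OF that] t] by simp
  ultimately show ?thesis by (subst measurable_cong) auto
qed

lemma attractor_point_measurable: "flow.attractor_point \<in> borel_measurable M"
proof (rule borel_measurable_LIMSEQ_metric)
  fix n show "(\<lambda>\<omega>. flow.pullback \<omega> n) \<in> borel_measurable M"
    unfolding flow.pullback_def
    using measurable_compose[OF shift_measurable flow_measurable[of n flow.barycentre]] by simp
qed (rule flow.pullback_tendsto)

lemma random_attractor:
  assumes nrm: "is_norm nrm"
  shows "random_attractor M \<theta> prob_simplex hilbert_metric nrm \<phi> (\<lambda>\<omega>. {flow.attractor_point \<omega>})"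
  unfolding random_attractor_def
proof (intro conjI allI ballI impI)
  have "(\<lambda>\<omega>. nrm (x - flow.attractor_point \<omega>)) \<in> borel_measurable M" for x
    using attractor_point_measurable
    by (intro borel_measurable_continuous_on[OF is_norm_continuous_on[OF nrm]] borel_measurable_diff) auto
  then show "compact_random_set M prob_simplex nrm (\<lambda>\<omega>. {flow.attractor_point \<omega>})"
    using flow.attractor_point_simplex by (auto simp: compact_random_set_def measurable_set_family_def)
next
  fix \<omega> t assume "\<omega> \<in> space M" "(0::real) \<le> t"
  then show "\<phi> t \<omega> ` {flow.attractor_point \<omega>} = {flow.attractor_point (\<theta> t \<omega>)}"
    by (simp add: flow.attractor_point_invariant)
next
  fix D \<omega> assume "compact_random_set M prob_simplex nrm D" "\<omega> \<in> space M"
  then show "((\<lambda>t. semi_dist hilbert_metric (\<phi> t (\<theta> (- t) \<omega>) ` D (\<theta> (- t) \<omega>)) {flow.attractor_point \<omega>}) \<longlongrightarrow> 0) at_top"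
    by (intro flow.attractor_point_pullback) (auto simp: compact_random_set_def)
qed

text \<open>Continuity of \<open>nrm\<close> at 0 transfers the Euclidean statement.\<close>

lemma attractor_stable:
  assumes nrm: "is_norm nrm" and \<omega>: "\<omega> \<in> space M" and p: "p \<in> prob_simplex"
  shows "((\<lambda>t. nrm (\<phi> t \<omega> p - flow.attractor_point (\<theta> t \<omega>))) \<longlongrightarrow> 0) at_top"
proof -
  have "isCont nrm 0"
    using is_norm_continuous_on[OF nrm] by (simp add: continuous_on_eq_continuous_at)
  from isCont_tendsto_compose[OF this flow.attractor_point_stable[OF \<omega> p]]
  have "((\<lambda>t. nrm (\<phi> t \<omega> p - flow.attractor_point (\<theta> t \<omega>))) \<longlongrightarrow> nrm 0) at_top" .
  moreover have "nrm 0 = 0" using nrm unfolding is_norm_def by blast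
  ultimately show ?thesis by (simp only:)
qed

end

theorem theorem4:
  fixes M :: "'w measure"
    and \<theta> :: "real \<Rightarrow> 'w \<Rightarrow> 'w"
    and q :: "nat \<Rightarrow> 'w \<Rightarrow> real"
    and c C :: real
    and nrm :: "real ^ 'n::{finite,linorder} \<Rightarrow> real"
  assumes "CARD('n) \<ge> 2"
    and "metric_dynamical_system M \<theta>"
    and "is_norm nrm"
    and "\<And>i. i \<in> {1..2 * CARD('n) - 2} \<Longrightarrow> q i \<in> borel_measurable M"
    and "0 < c"
    and "\<And>i \<omega>. i \<in> {1..2 * CARD('n) - 2} \<Longrightarrow> \<omega> \<in> space M \<Longrightarrow> c \<le> q i \<omega> \<and> q i \<omega> \<le> C"
  shows "let \<phi> = (rde_flow \<theta> q :: real \<Rightarrow> 'w \<Rightarrow> real ^ 'n::{finite,linorder} \<Rightarrow>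
      real ^ 'n::{finite,linorder}) in
    is_cocycle (space M) \<theta> prob_simplex \<phi> \<and>
    uniformly_dissipative (space M) prob_simplex hilbert_metric \<phi> \<and>
    uniformly_contractive (space M) prob_simplex hilbert_metric \<phi> \<and>
    (\<exists>A a. random_attractor M \<theta> prob_simplex hilbert_metric nrm \<phi> A \<and>
       (\<forall>\<omega>\<in>space M. A \<omega> = {a \<omega>}) \<and>
       (\<forall>p0\<in>open_prob_simplex. \<forall>\<omega>\<in>space M.
          ((\<lambda>t. nrm (\<phi> t \<omega> p0 - a (\<theta> t \<omega>))) \<longlongrightarrow> 0) at_top))"
proof -
  interpret metric_dynamical_system M \<theta> by fact
  interpret random_rate_equation M \<theta> q c C "TYPE('n)"
    using assms by unfold_locales auto
  show ?thesis
    unfolding Let_def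
    using flow.is_cocycle flow.uniformly_dissipative flow.uniformly_contractive
      random_attractor[OF assms(3)] attractor_stable[OF assms(3)]
    by (intro conjI exI[of _ "\<lambda>\<omega>. {flow.attractor_point \<omega>}"] exI[of _ flow.attractor_point])
       (auto simp: open_prob_simplex_def)
qed

end
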